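(* Let $n\in\mathbb{N}\setminus\{0,1\}$, let $t_1,t_2,T$ be numbers such that $0<t_1<t_2<T$, and let $u\in L^2((0,T)\times(-n,n))$ be such that $$u_t-u_{xx}+u_{xxx}=0\quad\text{in } (0,T)\times(-n,n)\qquad\text{and}\qquad \operatorname{supp}u\subset[t_1,t_2]\times(-n,n).$$ Then, for any $0<\varepsilon<\min(t_1,T-t_2)$, there exists $v\in L^2((0,T)\times(-n-1,n+1))$ satisfying $$v_t-v_{xx}+v_{xxx}=0\quad\text{in } (0,T)\times(-n-1,n+1),$$ $$\operatorname{supp}v\subset[t_1-\varepsilon,t_2+\varepsilon]\times(-n-1,n+1),$$ and $$\|v-u\|_{L^2((0,T)\times(-n+1,n-1))}<\varepsilon.$$
   Context: The first variable is time $t$, the second is space $x$. The equations are understood in the sense of distributions on the indicated open sets. *)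

theory Defs
  imports "HOL-Analysis.Analysis"
begin

text \<open>
  Points of the plane are pairs \<open>(t, x)\<close>: time first, space second. All functions are real-valued
  and defined on the whole plane; a function on \<open>\<Omega>\<close> is represented by any extension of it, and
  nothing below depends on the values outside \<open>\<Omega>\<close>. Elements of \<open>L\<^sup>2\<close> are represented by
  Borel measurable functions.
\<close>

definition L2_space :: "(real \<times> real) set \<Rightarrow> (real \<times> real \<Rightarrow> real) set" where
  "L2_space \<Omega> = {u. set_borel_measurable lborel \<Omega> u \<and> set_integrable lborel \<Omega> (\<lambda>z. (u z)\<^sup>2)}"

definition L2_norm :: "(real \<times> real) set \<Rightarrow> (real \<times> real \<Rightarrow> real) \<Rightarrow> real" where
  "L2_norm \<Omega> u = sqrt (set_lebesgue_integral lborel \<Omega> (\<lambda>z. (u z)\<^sup>2))"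

text \<open>
  The support of a measurable function on the open set \<open>\<Omega>\<close>, invariant under changes on null sets:
  the complement in \<open>\<Omega>\<close> of the largest open set on which the function vanishes almost everywhere.
  It is closed relative to \<open>\<Omega>\<close>, not necessarily in the plane.
\<close>

definition ess_support :: "(real \<times> real) set \<Rightarrow> (real \<times> real \<Rightarrow> real) \<Rightarrow> (real \<times> real) set" where
  "ess_support \<Omega> u = \<Omega> - \<Union>{W. open W \<and> W \<subseteq> \<Omega> \<and> (AE z in lborel. z \<in> W \<longrightarrow> u z = 0)}"

definition partial_t :: "(real \<times> real \<Rightarrow> real) \<Rightarrow> real \<times> real \<Rightarrow> real" where
  "partial_t \<phi> = (\<lambda>(t, x). deriv (\<lambda>s. \<phi> (s, x)) t)"

definition partial_x :: "(real \<times> real \<Rightarrow> real) \<Rightarrow> real \<times> real \<Rightarrow> real" where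
  "partial_x \<phi> = (\<lambda>(t, x). deriv (\<lambda>y. \<phi> (t, y)) x)"

fun C_k :: "nat \<Rightarrow> (real \<times> real \<Rightarrow> real) \<Rightarrow> bool" where
  "C_k 0 \<phi> \<longleftrightarrow> continuous_on UNIV \<phi>"
| "C_k (Suc k) \<phi> \<longleftrightarrow>
    (\<forall>z. \<phi> differentiable (at z)) \<and> C_k k (partial_t \<phi>) \<and> C_k k (partial_x \<phi>)"

definition test_functions :: "(real \<times> real) set \<Rightarrow> (real \<times> real \<Rightarrow> real) set" where
  "test_functions \<Omega> = {\<phi>. (\<forall>k. C_k k \<phi>) \<and>
     compact (closure {z. \<phi> z \<noteq> 0}) \<and> closure {z. \<phi> z \<noteq> 0} \<subseteq> \<Omega>}"

text \<open>
  Distributions are functionals applied to test functions. Only distributions induced by a function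
  and their derivatives occur, so linearity and continuity need not be imposed.
\<close>

type_synonym distribution = "(real \<times> real \<Rightarrow> real) \<Rightarrow> real"

definition dist_of :: "(real \<times> real) set \<Rightarrow> (real \<times> real \<Rightarrow> real) \<Rightarrow> distribution" where
  "dist_of \<Omega> u = (\<lambda>\<phi>. set_lebesgue_integral lborel \<Omega> (\<lambda>z. u z * \<phi> z))"

definition dist_t :: "distribution \<Rightarrow> distribution" where
  "dist_t \<Lambda> = (\<lambda>\<phi>. - \<Lambda> (partial_t \<phi>))"

definition dist_x :: "distribution \<Rightarrow> distribution" where
  "dist_x \<Lambda> = (\<lambda>\<phi>. - \<Lambda> (partial_x \<phi>))"

text \<open>The equation \<open>u\<^sub>t - u\<^sub>x\<^sub>x + u\<^sub>x\<^sub>x\<^sub>x = 0\<close> in the sense of distributions on \<open>\<Omega>\<close>.\<close>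

definition solves_KdVB :: "(real \<times> real) set \<Rightarrow> (real \<times> real \<Rightarrow> real) \<Rightarrow> bool" where
  "solves_KdVB \<Omega> u \<longleftrightarrow> (\<forall>\<phi> \<in> test_functions \<Omega>.
     dist_t (dist_of \<Omega> u) \<phi> - dist_x (dist_x (dist_of \<Omega> u)) \<phi>
       + dist_x (dist_x (dist_x (dist_of \<Omega> u))) \<phi> = 0)"

end

theory Submission
  imports Defs
begin

text \<open>
  The equation has order one in \<open>t\<close> and three in \<open>x\<close>. As an evolution equation in \<open>x\<close> it is solved by a
  power series in \<open>x\<close> that converges everywhere as soon as the Cauchy data on \<open>x = 0\<close> are Gevrey of
  order less than three in \<open>t\<close>. Mollifying \<open>u\<close> by a compactly supported function that is Gevrey of order
  two therefore gives a nearby solution that extends to all \<open>x\<close> with the same support in time.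

  To avoid traces of \<open>u\<close>, the extension is written as an integral of \<open>u\<close>. Let \<open>b\<close> be a Gevrey mollifier,
  \<open>\<Theta>\<close> the solution of \<open>\<Theta>\<^sub>t - \<Theta>\<^sub>x\<^sub>x + \<Theta>\<^sub>x\<^sub>x\<^sub>x = b(t) b(x)\<close> that vanishes for \<open>x\<close> far to the left, and
  \<open>\<zeta>\<close> a cutoff that rises from 0 to 1 in \<open>(-n, -n + 1)\<close>. Testing the equation for \<open>u\<close> against
  \<open>(s, y) \<mapsto> \<zeta>(y) \<Theta>(t - s, x - y)\<close> expresses the mollified \<open>u\<close> at \<open>(t, x)\<close>, \<open>\<bar>x\<bar> < n - 1\<close>, through the values of
  \<open>u\<close> at points \<open>(s, y)\<close> with \<open>\<zeta>'(y) \<noteq> 0\<close>. For these \<open>x - y\<close> lies to the right of the source \<open>b(x)\<close>, where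
  \<open>\<Theta>\<close> agrees with a solution of the homogeneous equation for all \<open>x\<close>; inserting the latter in the formula
  defines the extension.
\<close>

section \<open>Gevrey functions with compact support\<close>

text \<open>The span of these functions is closed under differentiation, which gives Gevrey bounds for all
  derivatives without any estimate in the complex plane.\<close>

definition flat :: "nat \<Rightarrow> real \<Rightarrow> real" where
  "flat i x = (if x > 0 then exp (- 1 / x) / x ^ i else 0)"

lemma flat_nonneg: "0 \<le> flat i x"
  by (simp add: flat_def)

text \<open>With \<open>y = 1 / x\<close> the claim compares one term of the series of
  \<open>exp y\<close> with its sum.\<close>

lemma flat_le_fact: "flat i x \<le> fact i"
proof (cases "x > 0")
  case True
  define y where "y = 1 / x"
  have "y > 0" using True by (simp add: y_def)
  have "y ^ i /\<^sub>R fact i \<le> exp y"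
    unfolding exp_def using sum_le_suminf[OF summable_exp_generic[of y], of "{i}"] \<open>y > 0\<close> by simp
  then have "y ^ i * exp (- y) \<le> fact i"
    by (simp add: exp_minus field_simps)
  then show ?thesis using True
    by (simp add: flat_def y_def power_one_over field_simps)
qed (simp add: flat_def)

text \<open>Two powers of \<open>x\<close> are traded for a larger index. The quadratic decay at 0
  is what differentiability there rests on.\<close>

lemma flat_le_square: "flat i x \<le> fact (i+2) * x\<^sup>2"
proof (cases "x > 0")
  case True
  then have "flat i x = flat (i+2) x * x\<^sup>2"
    by (simp add: flat_def power_add power2_eq_square)
  then show ?thesis
    using flat_le_fact[of "i+2" x] by (simp add: mult_right_mono)
qed (simp add: flat_def)

lemma DERIV_flat:
  "(flat i has_real_derivative flat (i+2) x - real i * flat (i+1) x) (at x)"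
proof -
  consider "x > 0" | "x < 0" | "x = 0" by linarith
  then show ?thesis
  proof cases
    case 1
    have "((\<lambda>x. exp (- 1 / x) / x ^ i) has_real_derivative flat (i+2) x - real i * flat (i+1) x) (at x)"
      using 1
      by (auto intro!: derivative_eq_intros simp: flat_def)
         (cases i; auto simp: field_simps power2_eq_square)
    then show ?thesis
      by (rule DERIV_cong_ev[THEN iffD1, rotated -1])
         (use 1 eventually_nhds_in_open[of "{0<..}" x] in \<open>auto simp: flat_def elim!: eventually_mono\<close>)
  next
    case 2
    have "((\<lambda>x. 0) has_real_derivative 0) (at x)" by simp
    then show ?thesis
      by (rule DERIV_cong_ev[THEN iffD1, rotated -1])
         (use 2 eventually_nhds_in_open[of "{..<0}" x] in \<open>auto simp: flat_def elim!: eventually_mono\<close>)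
  next
    case 3
    \<comment> \<open>At 0 every \<open>flat\<close> vanishes, so the claimed derivative is 0, and
      the quadratic bound squeezes the difference quotient.\<close>
    have "((\<lambda>h. flat i h / h) \<longlongrightarrow> 0) (at 0)"
    proof (rule Lim_null_comparison)
      show "\<forall>\<^sub>F h in at 0. norm (flat i h / h) \<le> fact (i+2) * \<bar>h\<bar>"
      proof (rule always_eventually, rule allI)
        fix h :: real
        have "norm (flat i h / h) = flat i h / \<bar>h\<bar>"
          by (simp add: flat_nonneg abs_divide)
        also have "\<dots> \<le> fact (i+2) * h\<^sup>2 / \<bar>h\<bar>"
          by (intro divide_right_mono flat_le_square) auto
        also have "\<dots> = fact (i+2) * \<bar>h\<bar>"
          by (cases "h = 0") (simp_all add: power2_eq_square abs_if)
        finally show "norm (flat i h / h) \<le> fact (i+2) * \<bar>h\<bar>" .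
      qed
      show "((\<lambda>h. fact (i+2) * \<bar>h\<bar>) \<longlongrightarrow> (0::real)) (at 0)"
        by (auto intro!: tendsto_eq_intros)
    qed
    then show ?thesis
      using 3 by (simp add: DERIV_def flat_def)
  qed
qed

text \<open>The \<open>k\<close>-th derivative of \<open>flat i (d + x) * flat j (d - x)\<close>.
  The recursion applies the rule of \<open>DERIV_flat\<close> to both factors and acts on the
  indices \<open>i\<close> and \<open>j\<close> only, so that no Leibniz sum appears.\<close>

fun bump :: "real \<Rightarrow> nat \<Rightarrow> nat \<Rightarrow> nat \<Rightarrow> real \<Rightarrow> real" where
  "bump d 0 i j x = flat i (d + x) * flat j (d - x)"
| "bump d (Suc k) i j x = bump d k (i+2) j x - real i * bump d k (i+1) j x
     - bump d k i (j+2) x + real j * bump d k i (j+1) x"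

lemma DERIV_bump: "(bump d k i j has_real_derivative bump d (Suc k) i j x) (at x)"
proof (induction k arbitrary: i j)
  case 0
  have 1: "((\<lambda>x. flat i (d + x)) has_real_derivative flat (i+2) (d + x) - real i * flat (i+1) (d + x)) (at x)"
  proof -
    have "((\<lambda>x. d + x) has_real_derivative 1) (at x)"
      by (auto intro!: derivative_eq_intros)
    from DERIV_chain'[OF this DERIV_flat] show ?thesis by simp
  qed
  have 2: "((\<lambda>x. flat j (d - x)) has_real_derivative - (flat (j+2) (d - x) - real j * flat (j+1) (d - x))) (at x)"
  proof -
    have "((\<lambda>x. d - x) has_real_derivative -1) (at x)"
      by (auto intro!: derivative_eq_intros)
    from DERIV_chain'[OF this DERIV_flat] show ?thesis by simp
  qed
  show ?case
    using DERIV_mult[OF 1 2] by (simp add: fun_eq_iff algebra_simps)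
next
  case (Suc k)
  have "((\<lambda>x. bump d k (i+2) j x - real i * bump d k (i+1) j x
     - bump d k i (j+2) x + real j * bump d k i (j+1) x) has_real_derivative bump d (Suc (Suc k)) i j x) (at x)"
    by (auto intro!: derivative_eq_intros Suc)
  then show ?case by simp
qed

lemma fact_mult_le: "fact a * fact b \<le> (fact (a + b) :: real)"
  using fact_fact_dvd_fact[of a b, where 'a=nat]
  by (metis dvd_imp_le fact_nonzero gr0I of_nat_fact of_nat_le_iff of_nat_mult)

text \<open>One differentiation gives four terms. Two have an index raised by two; the other two
  have an index raised by one and weights \<open>i\<close>, \<open>j\<close>, and one more factor of
  the factorial absorbs these weights together. For \<open>i = j = 0\<close> the growth is that of
  \<open>fact (2 * k)\<close>, which is Gevrey order two.\<close>

lemma bump_bound: "\<bar>bump d k i j x\<bar> \<le> 4 ^ k * fact (i + j + 2 * k)"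
proof (induction k arbitrary: i j)
  case 0
  have "flat i (d + x) * flat j (d - x) \<le> fact i * fact j"
    by (intro mult_mono flat_le_fact flat_nonneg) auto
  also have "\<dots> \<le> fact (i + j)"
    by (rule fact_mult_le)
  finally show ?case by (simp add: flat_nonneg)
next
  case (Suc k)
  let ?N = "i + j + 2 * k"
  let ?f = "fact (?N + 2) :: real"
  have a: "\<bar>bump d k (i+2) j x\<bar> \<le> 4^k * ?f" "\<bar>bump d k i (j+2) x\<bar> \<le> 4^k * ?f"
    using Suc[of "i+2" j] Suc[of i "j+2"] by (simp_all add: algebra_simps)
  have c: "\<bar>bump d k (i+1) j x\<bar> \<le> 4^k * fact (?N+1)" "\<bar>bump d k i (j+1) x\<bar> \<le> 4^k * fact (?N+1)"
    using Suc[of "i+1" j] Suc[of i "j+1"] by (simp_all add: algebra_simps)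
  have e: "\<bar>real i * bump d k (i+1) j x\<bar> \<le> real i * (4^k * fact (?N+1))"
    "\<bar>real j * bump d k i (j+1) x\<bar> \<le> real j * (4^k * fact (?N+1))"
    using c by (auto simp: abs_mult intro!: mult_left_mono)
  have g: "(real i + real j) * fact (?N + 1) \<le> ?f"
    by (auto simp: algebra_simps intro!: mult_right_mono)
  have "\<bar>bump d (Suc k) i j x\<bar> \<le> 4^k * ?f + 4^k * ?f + 4^k * ((real i + real j) * fact (?N+1))"
    using a e by (simp add: algebra_simps)
  also have "\<dots> \<le> 4^k * ?f + 4^k * ?f + 4^k * ?f"
    by (intro add_left_mono mult_left_mono g) auto
  also have "\<dots> \<le> 4 ^ Suc k * ?f" by simp
  finally show ?case by (simp add: algebra_simps)
qed

lemma bump_eq_0: "d \<le> \<bar>x\<bar> \<Longrightarrow> bump d k i j x = 0"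
  by (induction k arbitrary: i j) (auto simp: flat_def abs_if split: if_splits)

lemma bump_nonneg: "0 \<le> bump d 0 i j x"
  by (simp add: flat_nonneg)

lemma ex_gevrey_mollifier:
  assumes "d > 0"
  obtains b :: "nat \<Rightarrow> real \<Rightarrow> real" and C where
    "\<And>k x. (b k has_real_derivative b (Suc k) x) (at x)"
    "\<And>k x. d \<le> \<bar>x\<bar> \<Longrightarrow> b k x = 0"
    "\<And>k x. \<bar>b k x\<bar> \<le> C * 4 ^ k * fact (2 * k)"
    "\<And>x. 0 \<le> b 0 x" "(b 0 has_integral 1) {-d..d}"
proof -
  let ?g = "bump d 0 0 0"
  have cont: "continuous_on A ?g" for A
    by (meson DERIV_bump DERIV_isCont continuous_at_imp_continuous_on)
  have int: "?g integrable_on {-d..d}"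
    by (intro integrable_continuous_interval cont)
  define c where "c = integral {-d..d} ?g"
  \<comment> \<open>A nonnegative continuous function with integral 0 vanishes on the interval, but
    the bump is positive at 0.\<close>
  have "c \<noteq> 0"
  proof
    assume "c = 0"
    then have "?g 0 = 0"
      using integral_eq_0_iff[of "-d" d ?g, OF cont] \<open>d > 0\<close> bump_nonneg
      by (simp add: c_def del: bump.simps)
    then show False using \<open>d > 0\<close> by (simp add: flat_def)
  qed
  moreover have "c \<ge> 0" unfolding c_def by (intro integral_nonneg int) (auto simp: flat_nonneg)
  ultimately have c: "c > 0" by simp
  show ?thesis
  proof (rule that[of "\<lambda>k x. bump d k 0 0 x / c" "1/c"])
    show "((\<lambda>x. bump d 0 0 0 x / c) has_integral 1) {-d..d}"
      using has_integral_divide[OF integrable_integral[OF int], of c] c by (simp add: c_def)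
    show "((\<lambda>x. bump d k 0 0 x / c) has_real_derivative bump d (Suc k) 0 0 x / c) (at x)" for k x
      by (intro DERIV_cdivide DERIV_bump)
    show "\<bar>bump d k 0 0 x / c\<bar> \<le> 1 / c * 4 ^ k * fact (2 * k)" for k x
      using bump_bound[of d k 0 0 x] c by (simp add: divide_right_mono)
  qed (use c in \<open>auto simp: bump_eq_0 flat_nonneg\<close>)
qed

section \<open>Smooth functions of two variables\<close>

text \<open>\<open>f m l\<close> stands for the derivative of \<open>f 0 0\<close> of order \<open>m\<close> in \<open>t\<close> and \<open>l\<close> in \<open>x\<close>.\<close>

definition smooth_family :: "(nat \<Rightarrow> nat \<Rightarrow> real \<times> real \<Rightarrow> real) \<Rightarrow> bool" where
  "smooth_family f \<longleftrightarrow> (\<forall>m l. continuous_on UNIV (f m l) \<and>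
     (\<forall>t x. ((\<lambda>s. f m l (s, x)) has_real_derivative f (Suc m) l (t, x)) (at t) \<and>
            ((\<lambda>y. f m l (t, y)) has_real_derivative f m (Suc l) (t, x)) (at x)))"

lemma smooth_familyD:
  assumes "smooth_family f"
  shows "continuous_on A (f m l)"
    and "((\<lambda>s. f m l (s, x)) has_real_derivative f (Suc m) l (t, x)) (at t)"
    and "((\<lambda>y. f m l (t, y)) has_real_derivative f m (Suc l) (t, x)) (at x)"
  using assms continuous_on_subset[of UNIV "f m l" A] by (auto simp: smooth_family_def)

lemma smooth_family_partials:
  assumes "smooth_family f"
  shows "partial_t (f m l) = f (Suc m) l" "partial_x (f m l) = f m (Suc l)"
  using smooth_familyD(2,3)[OF assms]
  by (auto simp: partial_t_def partial_x_def fun_eq_iff intro!: DERIV_imp_deriv)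

text \<open>Continuous partial derivatives give a total derivative. The criterion wants the partial
  in \<open>x\<close> as a continuous map into bounded linear maps, hence the \<open>blinfun\<close>
  form.\<close>

lemma smooth_family_differentiable:
  assumes "smooth_family f"
  shows "f m l differentiable (at z)"
proof -
  obtain t x where z: "z = (t, x)" by (cases z)
  have "((\<lambda>(t, x). f m l (t, x)) has_derivative
      (\<lambda>(s, y). f (Suc m) l (t, x) * s + blinfun_apply (blinfun_mult_right (f m (Suc l) (t, x))) y))
      (at (t, x) within UNIV \<times> UNIV)"
  proof (rule has_derivative_partialsI)
    show "((\<lambda>t. f m l (t, x)) has_derivative (\<lambda>s. f (Suc m) l (t, x) * s)) (at t within UNIV)"
      using smooth_familyD(2)[OF assms] by (simp add: has_field_derivative_def)
    show "((\<lambda>x. f m l (t, x)) has_derivative blinfun_apply (blinfun_mult_right (f m (Suc l) (t, x))))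
        (at x within UNIV)" for t x
      using smooth_familyD(3)[OF assms, of m l t x] by (simp add: has_field_derivative_def)
    have "continuous_on UNIV (\<lambda>z. blinfun_mult_right (f m (Suc l) z))"
      by (intro continuous_intros smooth_familyD(1)[OF assms])
    then show "continuous (at (t, x) within UNIV \<times> UNIV) (\<lambda>(t, x). blinfun_mult_right (f m (Suc l) (t, x)))"
      by (simp add: continuous_on_eq_continuous_within split_def)
  qed auto
  then show ?thesis
    unfolding z differentiable_def by (auto simp: split_def)
qed

lemma smooth_family_C_k:
  assumes "smooth_family f"
  shows "C_k k (f m l)"
  by (induction k arbitrary: m l)
     (simp_all add: smooth_family_partials[OF assms] smooth_familyD(1)[OF assms]
        smooth_family_differentiable[OF assms])

text \<open>Every derivative in \<open>s\<close> or \<open>y\<close> of a function of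
  \<open>(t - s, x - y)\<close> costs a factor -1. The form is needed because the equation is tested
  in \<open>(s, y)\<close> with \<open>(t, x)\<close> fixed.\<close>

lemma smooth_family_reflect:
  assumes "smooth_family f"
  shows "smooth_family (\<lambda>m l (s, y). (-1) ^ (m + l) * f m l (t - s, x - y))"
  unfolding smooth_family_def
proof (intro allI conjI)
  fix m l s y
  have "continuous_on UNIV (\<lambda>z. (-1) ^ (m + l) * f m l (t - fst z, x - snd z))"
    by (intro continuous_intros continuous_on_compose2[OF smooth_familyD(1)[OF assms, of UNIV]]) auto
  then show "continuous_on UNIV (\<lambda>(s, y). (-1) ^ (m + l) * f m l (t - s, x - y))"
    by (simp add: split_def)
  have d: "((\<lambda>s. t - s) has_real_derivative -1) (at s)" "((\<lambda>y. x - y) has_real_derivative -1) (at y)"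
    by (auto intro!: derivative_eq_intros)
  show "((\<lambda>s. case (s, y) of (s, y) \<Rightarrow> (-1) ^ (m + l) * f m l (t - s, x - y)) has_real_derivative
      (case (s, y) of (s, y) \<Rightarrow> (-1) ^ (Suc m + l) * f (Suc m) l (t - s, x - y))) (at s)"
    using DERIV_cmult[OF DERIV_chain'[OF d(1) smooth_familyD(2)[OF assms]], of "(-1) ^ (m + l)" m l "x - y"]
    by (simp add: algebra_simps)
  show "((\<lambda>y. case (s, y) of (s, y) \<Rightarrow> (-1) ^ (m + l) * f m l (t - s, x - y)) has_real_derivative
      (case (s, y) of (s, y) \<Rightarrow> (-1) ^ (m + Suc l) * f m (Suc l) (t - s, x - y))) (at y)"
    using DERIV_cmult[OF DERIV_chain'[OF d(2) smooth_familyD(3)[OF assms]], of "(-1) ^ (m + l)" m l "t - s"]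
    by (simp add: algebra_simps)
qed

section \<open>Sums and products of \<open>C_k\<close> functions\<close>

lemma differentiable_imp_partials:
  assumes "\<phi> differentiable (at (t, x))"
  shows "((\<lambda>s. \<phi> (s, x)) has_real_derivative partial_t \<phi> (t, x)) (at t)"
    and "((\<lambda>y. \<phi> (t, y)) has_real_derivative partial_x \<phi> (t, x)) (at x)"
proof -
  have 1: "(\<lambda>s. (s, x)) differentiable (at t)"
    unfolding differentiable_def by (intro exI, rule has_derivative_Pair[OF has_derivative_ident has_derivative_const])
  have 2: "(\<lambda>y. (t, y)) differentiable (at x)"
    unfolding differentiable_def by (intro exI, rule has_derivative_Pair[OF has_derivative_const has_derivative_ident])
  have "(\<lambda>s. \<phi> (s, x)) differentiable (at t)"
    using differentiable_chain_at[of "\<lambda>s. (s, x)" t \<phi>] 1 assms by (simp add: o_def)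
  then show "((\<lambda>s. \<phi> (s, x)) has_real_derivative partial_t \<phi> (t, x)) (at t)"
    by (simp add: partial_t_def DERIV_deriv_iff_real_differentiable)
  have "(\<lambda>y. \<phi> (t, y)) differentiable (at x)"
    using differentiable_chain_at[of "\<lambda>y. (t, y)" x \<phi>] 2 assms by (simp add: o_def)
  then show "((\<lambda>y. \<phi> (t, y)) has_real_derivative partial_x \<phi> (t, x)) (at x)"
    by (simp add: partial_x_def DERIV_deriv_iff_real_differentiable)
qed

text \<open>\<open>C_k\<close> requires continuity explicitly only of the derivatives of top order;
  below that it follows from total differentiability.\<close>

lemma C_k_mono: "C_k (Suc k) \<phi> \<Longrightarrow> C_k k \<phi>"
proof (induction k arbitrary: \<phi>)
  case 0
  then have "\<phi> differentiable_on UNIV"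
    by (simp add: differentiable_on_def)
  then show ?case
    by (simp add: differentiable_imp_continuous_on)
next
  case (Suc k)
  have "C_k (Suc k) (partial_t \<phi>)" "C_k (Suc k) (partial_x \<phi>)"
    using Suc.prems unfolding C_k.simps(2)[of "Suc k"] by blast+
  then have "C_k k (partial_t \<phi>)" "C_k k (partial_x \<phi>)"
    using Suc.IH by blast+
  moreover have "\<forall>z. \<phi> differentiable (at z)"
    using Suc.prems by (simp only: C_k.simps simp_thms)
  ultimately show ?case by (simp only: C_k.simps simp_thms)
qed

lemma C_k_add: "C_k k f \<Longrightarrow> C_k k g \<Longrightarrow> C_k k (\<lambda>z. f z + g z)"
proof (induction k arbitrary: f g)
  case 0
  then show ?case by (auto intro: continuous_intros)
next
  case (Suc k)
  have "partial_t (\<lambda>z. f z + g z) = (\<lambda>z. partial_t f z + partial_t g z)"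
    "partial_x (\<lambda>z. f z + g z) = (\<lambda>z. partial_x f z + partial_x g z)"
    using Suc.prems differentiable_imp_partials[of f] differentiable_imp_partials[of g]
    by (auto simp: fun_eq_iff partial_t_def[of "\<lambda>z. f z + g z"] partial_x_def[of "\<lambda>z. f z + g z"]
        intro!: DERIV_imp_deriv DERIV_add)
  moreover have "C_k k (\<lambda>z. partial_t f z + partial_t g z)" "C_k k (\<lambda>z. partial_x f z + partial_x g z)"
    using Suc.prems Suc.IH[of "partial_t f" "partial_t g"] Suc.IH[of "partial_x f" "partial_x g"]
    by (simp_all only: C_k.simps simp_thms)
  ultimately show ?case using Suc.prems by (simp only: C_k.simps differentiable_add simp_thms)
qed

lemma partial_mult:
  assumes "\<And>z. f differentiable (at z)" "\<And>z. g differentiable (at z)"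
  shows "partial_t (\<lambda>z. f z * g z) = (\<lambda>z. partial_t f z * g z + f z * partial_t g z)"
    "partial_x (\<lambda>z. f z * g z) = (\<lambda>z. partial_x f z * g z + f z * partial_x g z)"
proof -
  have "deriv (\<lambda>s. f (s, x) * g (s, x)) t = partial_t f (t, x) * g (t, x) + f (t, x) * partial_t g (t, x)" for t x
    using DERIV_mult[OF differentiable_imp_partials(1)[OF assms(1)] differentiable_imp_partials(1)[OF assms(2)]]
    by (intro DERIV_imp_deriv) (simp add: algebra_simps)
  then show "partial_t (\<lambda>z. f z * g z) = (\<lambda>z. partial_t f z * g z + f z * partial_t g z)"
    by (auto simp: partial_t_def[of "\<lambda>z. f z * g z"])
  have "deriv (\<lambda>y. f (t, y) * g (t, y)) x = partial_x f (t, x) * g (t, x) + f (t, x) * partial_x g (t, x)" for t x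
    using DERIV_mult[OF differentiable_imp_partials(2)[OF assms(1)] differentiable_imp_partials(2)[OF assms(2)]]
    by (intro DERIV_imp_deriv) (simp add: algebra_simps)
  then show "partial_x (\<lambda>z. f z * g z) = (\<lambda>z. partial_x f z * g z + f z * partial_x g z)"
    by (auto simp: partial_x_def[of "\<lambda>z. f z * g z"])
qed

lemma C_k_mult: "C_k k f \<Longrightarrow> C_k k g \<Longrightarrow> C_k k (\<lambda>z. f z * g z)"
proof (induction k arbitrary: f g)
  case 0
  then show ?case by (auto intro: continuous_intros)
next
  case (Suc k)
  have d: "\<And>z. f differentiable (at z)" "\<And>z. g differentiable (at z)"
    using Suc.prems by auto
  \<comment> \<open>The product rule pairs a derivative of one factor with the other factor itself,
    so the factors are needed at the lower order too.\<close>
  have c: "C_k k f" "C_k k g" "C_k k (partial_t f)" "C_k k (partial_t g)" "C_k k (partial_x f)" "C_k k (partial_x g)"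
    using C_k_mono[OF Suc.prems(1)] C_k_mono[OF Suc.prems(2)] Suc.prems by auto
  have "C_k k (\<lambda>z. partial_t f z * g z + f z * partial_t g z)" "C_k k (\<lambda>z. partial_x f z * g z + f z * partial_x g z)"
    by (intro C_k_add Suc.IH c)+
  then show ?case
    using d by (simp only: C_k.simps partial_mult[OF d] differentiable_mult simp_thms)
qed

lemma smooth_family_of_x:
  assumes "\<And>k x. (X k has_real_derivative X (Suc k) x) (at x)"
  shows "smooth_family (\<lambda>m l (t, x). if m = 0 then X l x else 0)"
proof -
  have "continuous_on UNIV (X l)" for l
    using DERIV_isCont[OF assms] by (simp add: continuous_at_imp_continuous_on)
  then have "continuous_on UNIV (\<lambda>z. if m = (0::nat) then X l (snd z) else 0)" for m l
    by (cases "m = 0") (auto intro!: continuous_on_compose2[of UNIV "X l" UNIV snd] continuous_on_snd continuous_on_id)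
  then show ?thesis
    using assms by (auto simp: smooth_family_def split_def)
qed

section \<open>Solutions with Gevrey data\<close>

text \<open>The coefficients of the formal power series in \<open>z\<close> that solves the equation with Cauchy data
  \<open>(0, 0, b)\<close> at \<open>z = 0\<close>; \<open>psi b m k\<close> is the \<open>k\<close>-th derivative of the \<open>m\<close>-th coefficient.\<close>

fun psi :: "(nat \<Rightarrow> real \<Rightarrow> real) \<Rightarrow> nat \<Rightarrow> nat \<Rightarrow> real \<Rightarrow> real" where
  "psi b 0 k r = 0"
| "psi b (Suc 0) k r = 0"
| "psi b (Suc (Suc 0)) k r = b k r"
| "psi b (Suc (Suc (Suc m))) k r = psi b (Suc (Suc m)) k r - psi b m (Suc k) r"

text \<open>Dividing by \<open>fact j\<close> makes each derivative in \<open>z\<close> a shift of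
  the coefficient index, so \<open>l\<close> such derivatives turn \<open>j\<close> into
  \<open>j + l\<close>; the \<open>m\<close> derivatives in time act on the coefficients.\<close>

definition Psi :: "(nat \<Rightarrow> real \<Rightarrow> real) \<Rightarrow> nat \<Rightarrow> nat \<Rightarrow> real \<times> real \<Rightarrow> real" where
  "Psi b m l = (\<lambda>(r, z). \<Sum>j. psi b (j + l) m r / fact j * z ^ j)"

section \<open>Convergence of the series for data of Gevrey order two\<close>

lemma fact_add_le: "fact (a + b) \<le> (2::real) ^ (a + b) * (fact a * fact b)"
proof -
  have "fact a * fact b * ((a + b) choose a) = (fact (a + b) :: nat)"
    using binomial_fact_lemma[of a "a + b"] by simp
  then have "(fact (a + b) :: real) = fact a * fact b * real ((a + b) choose a)"
    by (metis of_nat_fact of_nat_mult)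
  also have "\<dots> \<le> fact a * fact b * 2 ^ (a + b)"
    using binomial_le_pow2[of "a + b" a]
    by (intro mult_left_mono) (auto simp flip: of_nat_le_iff)
  finally show ?thesis by (simp add: mult.commute)
qed

text \<open>With \<open>q = m div 3\<close>, the numerator grows like \<open>fact (2 * q)\<close> up
  to geometric factors, while \<open>fact m\<close> is at least
  \<open>fact (2 * q) * fact q\<close>. The surplus \<open>fact q\<close> beats every power
  \<open>X ^ m\<close>; here Gevrey order two lies below the critical order three.\<close>

lemma summable_gevrey_majorant_aux:
  fixes X :: real
  assumes "X \<ge> 1"
  shows "summable (\<lambda>m. 2 ^ m * (4 ^ (k + m div 3) * fact (2 * (k + m div 3))) * X ^ m / fact m)"
proof (rule summable_comparison_test')
  \<comment> \<open>The powers \<open>2 ^ m\<close>, \<open>4 ^ m * 4 ^ m\<close> and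
    \<open>X ^ m\<close> make up \<open>(32 * X) ^ m\<close>. The remaining factor two pays for the
    geometric series of ratio 1/2.\<close>
  define Y where "Y = 64 * X"
  define D :: real where "D = 4 ^ k * 4 ^ k * fact (2 * k) * (Y\<^sup>2 * exp (Y ^ 3))"
  have Y: "Y \<ge> 1" using assms by (simp add: Y_def)
  show "summable (\<lambda>m. D * (1 / 2) ^ m)"
    by (intro summable_mult summable_geometric) auto
  fix m :: nat
  define q where "q = m div 3"
  have "fact (2 * (k + q)) \<le> (2::real) ^ (2 * k + 2 * q) * (fact (2 * k) * fact (2 * q))"
    using fact_add_le[of "2 * k" "2 * q"] by (simp add: algebra_simps)
  also have "\<dots> = 4 ^ k * 4 ^ q * fact (2 * k) * fact (2 * q)"
    by (simp add: power_add power_mult)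
  finally have 1: "fact (2 * (k + q)) \<le> (4 ^ k * 4 ^ q * fact (2 * k) * fact (2 * q) :: real)" .
  have "fact (2 * q) * fact q \<le> (fact (2 * q + q) :: real)"
    by (rule fact_mult_le)
  also have "\<dots> \<le> fact m" by (rule fact_mono) (simp add: q_def)
  finally have 2: "fact (2 * q) * fact q \<le> (fact m :: real)" .
  have e: "Y ^ (3 * q) / fact q \<le> exp (Y ^ 3)"
  proof -
    have "(Y ^ 3) ^ q /\<^sub>R fact q \<le> exp (Y ^ 3)"
      unfolding exp_def using sum_le_suminf[OF summable_exp_generic[of "Y ^ 3"], of "{q}"] Y by simp
    then show ?thesis unfolding power_mult by (simp add: divide_inverse mult.commute)
  qed
  \<comment> \<open>Since \<open>m\<close> is at most \<open>3 * q + 2\<close>, all but two factors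
    \<open>Y\<close> go into a term of the series of \<open>exp (Y ^ 3)\<close>.\<close>
  have 3: "Y ^ m / fact q \<le> Y\<^sup>2 * exp (Y ^ 3)"
  proof -
    have "Y ^ m \<le> Y ^ (2 + 3 * q)"
      using Y by (intro power_increasing) (auto simp: q_def)
    then have "Y ^ m / fact q \<le> Y ^ (2 + 3 * q) / fact q"
      by (intro divide_right_mono) auto
    also have "\<dots> = Y\<^sup>2 * (Y ^ (3 * q) / fact q)" unfolding power_add by simp
    also have "\<dots> \<le> Y\<^sup>2 * exp (Y ^ 3)"
      by (intro mult_left_mono e) auto
    finally show ?thesis .
  qed
  have alg: "p * (a * c * (a * c * u * v)) * x / (v * w) = a * a * u * (p * (c * c) * x / w)"
    if "v \<noteq> 0" "w \<noteq> 0" for p a c u v w x :: real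
    using that by (simp add: divide_simps)
  have "2 ^ m * (4 ^ (k + q) * fact (2 * (k + q))) * X ^ m / fact m
      \<le> 2 ^ m * (4 ^ (k + q) * (4 ^ k * 4 ^ q * fact (2 * k) * fact (2 * q))) * X ^ m / (fact (2 * q) * fact q)"
    using assms 1 2 by (intro frac_le mult_right_mono mult_left_mono) auto
  also have "\<dots> = 4 ^ k * 4 ^ k * fact (2 * k) * (2 ^ m * (4 ^ q * 4 ^ q) * X ^ m / fact q)"
    unfolding power_add by (rule alg) auto
  also have "\<dots> \<le> 4 ^ k * 4 ^ k * fact (2 * k) * (2 ^ m * (4 ^ m * 4 ^ m) * X ^ m / fact q)"
    using assms
    by (intro mult_left_mono divide_right_mono mult_right_mono mult_mono power_increasing) (auto simp: q_def)
  also have "2 ^ m * (4 ^ m * 4 ^ m) * X ^ m = Y ^ m * (1/2) ^ m"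
    unfolding power_mult_distrib[symmetric] by (simp add: Y_def)
  also have "4 ^ k * 4 ^ k * fact (2 * k) * (Y ^ m * (1/2) ^ m / fact q)
      = 4 ^ k * 4 ^ k * fact (2 * k) * (Y ^ m / fact q) * (1/2) ^ m"
    by (simp only: mult.assoc times_divide_eq_left times_divide_eq_right)
  also have "\<dots> \<le> D * (1/2) ^ m"
    unfolding D_def by (intro mult_right_mono mult_left_mono 3) auto
  finally show "norm (2 ^ m * (4 ^ (k + m div 3) * fact (2 * (k + m div 3))) * X ^ m / fact m) \<le> D * (1/2) ^ m"
    using assms by (simp add: q_def)
qed

text \<open>Replacing \<open>fact j\<close> by \<open>fact (j + l)\<close> costs
  \<open>fact l * 2 ^ (j + l)\<close>; the power of two doubles \<open>X\<close> in the previous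
  estimate.\<close>

lemma summable_gevrey_majorant:
  fixes X :: real
  assumes "X \<ge> 1"
  shows "summable (\<lambda>j. 2 ^ (j + l) * (4 ^ (k + (j + l) div 3) * fact (2 * (k + (j + l) div 3))) / fact j * X ^ j)"
proof (rule summable_comparison_test')
  let ?B = "\<lambda>m. 2 ^ m * (4 ^ (k + m div 3) * fact (2 * (k + m div 3))) :: real"
  show "summable (\<lambda>j. fact l * (?B (j + l) * (2 * X) ^ (j + l) / fact (j + l)))"
    using summable_ignore_initial_segment[OF summable_gevrey_majorant_aux[of "2 * X" k], of l] assms
    by (intro summable_mult) simp
  fix j
  have "(fact (j + l) :: real) \<le> 2 ^ (j + l) * (fact j * fact l)" by (rule fact_add_le)
  then have "1 / fact j \<le> fact l * 2 ^ (j + l) / (fact (j + l) :: real)"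
    by (simp add: field_simps)
  then have "?B (j + l) * X ^ j * (1 / fact j) \<le> ?B (j + l) * X ^ (j + l) * (fact l * 2 ^ (j + l) / fact (j + l))"
    using assms by (intro mult_mono mult_left_mono power_increasing) auto
  then show "norm (?B (j + l) / fact j * X ^ j) \<le> fact l * (?B (j + l) * (2 * X) ^ (j + l) / fact (j + l))"
    using assms by (simp add: field_simps power_mult_distrib)
qed

text \<open>Shaped after the recursion of \<open>psi\<close>, whose step refers to \<open>m\<close>
  and \<open>m + 2\<close>.\<close>

lemma nat_induct_3_step:
  assumes "P 0" "P (Suc 0)" "P (Suc (Suc 0))" "\<And>m. P m \<Longrightarrow> P (Suc (Suc m)) \<Longrightarrow> P (Suc (Suc (Suc m)))"
  shows "P (m :: nat)"
proof (induction m rule: less_induct)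
  case (less m)
  show ?case
  proof (cases "m < 3")
    case True
    then have "m = 0 \<or> m = Suc 0 \<or> m = Suc (Suc 0)" by auto
    then show ?thesis using assms by auto
  next
    case False
    then have "m = Suc (Suc (Suc (m - 3)))" by auto
    then show ?thesis using assms(4)[of "m - 3"] less[of "m - 3"] less[of "Suc (Suc (m - 3))"] by auto
  qed
qed

section \<open>The series solution and its convolution with the mollifier\<close>

locale gevrey_mollifier =
  fixes b :: "nat \<Rightarrow> real \<Rightarrow> real" and C d :: real
  assumes b_deriv: "(b k has_real_derivative b (Suc k) x) (at x)"
    and b_support: "d \<le> \<bar>x\<bar> \<Longrightarrow> b k x = 0"
    and b_bound: "\<bar>b k x\<bar> \<le> C * 4 ^ k * fact (2 * k)"
begin

lemma C_nonneg: "0 \<le> C"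
  using b_bound[of 0 0] by simp

lemma b_continuous: "continuous_on A (b k)"
  using DERIV_isCont[OF b_deriv] by (simp add: continuous_at_imp_continuous_on)

lemma psi_deriv: "(psi b m k has_real_derivative psi b m (Suc k) r) (at r)"
proof (induction m arbitrary: k rule: nat_induct_3_step)
  case (4 m)
  have "((\<lambda>r. psi b (Suc (Suc m)) k r - psi b m (Suc k) r) has_real_derivative
      psi b (Suc (Suc m)) (Suc k) r - psi b m (Suc (Suc k)) r) (at r)"
    by (intro DERIV_diff 4)
  then show ?case by simp
next
  case 3
  have "psi b (Suc (Suc 0)) k = b k" for k by (simp add: fun_eq_iff)
  then show ?case by (simp add: b_deriv)
next
  case 2
  have "psi b (Suc 0) k = (\<lambda>r. 0)" for k by (simp add: fun_eq_iff)
  then show ?case by simp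
next
  case 1
  have "psi b 0 k = (\<lambda>r. 0)" for k by (simp add: fun_eq_iff)
  then show ?case by simp
qed

lemma psi_support: "d \<le> \<bar>r\<bar> \<Longrightarrow> psi b m k r = 0"
  by (induction m arbitrary: k rule: nat_induct_3_step) (simp_all add: b_support)

text \<open>The factor \<open>2 ^ m\<close> allows for the two terms of the recursion of
  \<open>psi\<close>. A derivative of \<open>b\<close> is spent only together with three steps in
  \<open>m\<close>, which accounts for \<open>m div 3\<close> derivatives beyond the
  \<open>k\<close> given ones.\<close>

definition majorant :: "nat \<Rightarrow> nat \<Rightarrow> real" where
  "majorant k m = 2 ^ m * (4 ^ (k + m div 3) * fact (2 * (k + m div 3)))"

lemma psi_bound: "\<bar>psi b m k r\<bar> \<le> C * majorant k m"
proof (induction m arbitrary: k rule: nat_induct_3_step)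
  case 3
  have "\<bar>b k r\<bar> \<le> C * 4 ^ k * fact (2 * k)" by (rule b_bound)
  also have "\<dots> \<le> 4 * (C * 4 ^ k * fact (2 * k))" using C_nonneg by simp
  finally show ?case by (simp add: majorant_def)
next
  case (4 m)
  let ?M = "\<lambda>q. 4 ^ q * fact (2 * q) :: real"
  have mono: "?M p \<le> ?M q" if "p \<le> q" for p q
    using that by (intro mult_mono power_increasing fact_mono) auto
  have q: "Suc (Suc (Suc m)) div 3 = Suc (m div 3)" by simp
  have "\<bar>psi b (Suc (Suc (Suc m))) k r\<bar> \<le> C * majorant k (Suc (Suc m)) + C * majorant (Suc k) m"
    using 4[of k] 4[of "Suc k"] by simp
  \<comment> \<open>Both terms are compared with the same order \<open>k + Suc (m div 3)\<close>: it
    is an upper bound for the first and exact for the second. Their equal bounds then add up to the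
    next power of two.\<close>
  also have "majorant k (Suc (Suc m)) \<le> 2 ^ Suc (Suc m) * ?M (k + Suc (m div 3))"
    unfolding majorant_def by (intro mult_left_mono mono) auto
  also have "majorant (Suc k) m \<le> 2 ^ Suc (Suc m) * ?M (k + Suc (m div 3))"
    unfolding majorant_def by (intro mult_mono mono) auto
  also have "C * (2 ^ Suc (Suc m) * ?M (k + Suc (m div 3))) + C * (2 ^ Suc (Suc m) * ?M (k + Suc (m div 3)))
      = C * majorant k (Suc (Suc (Suc m)))"
    unfolding majorant_def q by simp
  finally show ?case using C_nonneg by (simp add: mult_left_mono)
qed (simp_all add: C_nonneg majorant_def)

lemma Psi_term_bound:
  assumes "\<bar>z\<bar> \<le> X"
  shows "norm (psi b (j + l) m r / fact j * z ^ j) \<le> C * (majorant m (j + l) / fact j * X ^ j)"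
proof -
  have "\<bar>z\<bar> ^ j \<le> X ^ j" using assms by (intro power_mono) auto
  then have "\<bar>psi b (j + l) m r\<bar> / fact j * \<bar>z\<bar> ^ j \<le> C * majorant m (j + l) / fact j * X ^ j"
    using psi_bound[of "j + l" m r] C_nonneg
    by (intro mult_mono divide_right_mono) (auto simp: majorant_def)
  then show ?thesis by (simp add: abs_mult power_abs)
qed

lemma summable_Psi_majorant: "1 \<le> X \<Longrightarrow> summable (\<lambda>j. C * (majorant m (j + l) / fact j * X ^ j))"
  using summable_gevrey_majorant[of X l m] by (intro summable_mult) (simp add: majorant_def)

lemma summable_Psi: "summable (\<lambda>j. psi b (j + l) m r / fact j * z ^ j)"
  by (rule summable_comparison_test'[OF summable_Psi_majorant[of "max 1 \<bar>z\<bar>"] Psi_term_bound]) auto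

lemma Psi_uniform_limit:
  assumes "1 \<le> X"
  shows "uniform_limit (UNIV \<times> {-X..X}) (\<lambda>N (r, z). \<Sum>j<N. psi b (j + l) m r / fact j * z ^ j)
    (Psi b m l) sequentially"
  unfolding Psi_def split_def
  by (rule Weierstrass_m_test[OF Psi_term_bound summable_Psi_majorant[OF assms]]) auto

text \<open>Convergence is uniform only on strips of bounded \<open>z\<close>; continuity is local
  and passes to the union of the open strips.\<close>

lemma Psi_continuous: "continuous_on UNIV (Psi b m l)"
proof -
  have psi_cont: "continuous_on A (psi b j k)" for A j k
    using DERIV_isCont[OF psi_deriv] by (simp add: continuous_at_imp_continuous_on)
  have c: "continuous_on (UNIV \<times> {-X..X}) (Psi b m l)" if "1 \<le> X" for X
    by (rule uniform_limit_theorem[OF _ Psi_uniform_limit[OF that]])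
       (auto simp: split_def intro!: always_eventually continuous_intros continuous_on_compose2[OF psi_cont[of UNIV]])
  have "continuous_on (UNIV \<times> {-X<..<X}) (Psi b m l)" if "1 \<le> X" for X
    by (rule continuous_on_subset[OF c[OF that]]) auto
  then have "continuous_on (\<Union>X\<in>{1..}. UNIV \<times> {-X<..<X}) (Psi b m l)"
    by (intro continuous_on_open_UN) (simp_all add: open_Times)
  moreover have "(\<Union>X\<in>{1..}. UNIV \<times> {-X<..<X}) = (UNIV :: (real \<times> real) set)"
  proof -
    have "z \<in> (\<Union>X\<in>{1..}. UNIV \<times> {-X<..<X})" for z :: "real \<times> real"
      by (cases z, rule UN_I[of "1 + \<bar>snd z\<bar>"]) auto
    then show ?thesis by blast
  qed
  ultimately show ?thesis by simp
qed

lemma Psi_deriv_t: "((\<lambda>s. Psi b m l (s, z)) has_real_derivative Psi b (Suc m) l (r, z)) (at r)"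
proof -
  define X where "X = max 1 \<bar>z\<bar>"
  have "((\<lambda>s. \<Sum>j. psi b (j + l) m s / fact j * z ^ j) has_real_derivative
      (\<Sum>j. psi b (j + l) (Suc m) r / fact j * z ^ j)) (at r)"
  proof (rule has_field_derivative_series'(2)[where S = UNIV and ?x0.0 = r])
    show "((\<lambda>s. psi b (n + l) m s / fact n * z ^ n) has_real_derivative psi b (n + l) (Suc m) x / fact n * z ^ n)
        (at x within UNIV)" for n x
      by (intro DERIV_cmult_right DERIV_cdivide) (simp add: psi_deriv)
    show "uniformly_convergent_on UNIV (\<lambda>n x. \<Sum>i<n. psi b (i + l) (Suc m) x / fact i * z ^ i)"
      by (rule Weierstrass_m_test'[OF Psi_term_bound summable_Psi_majorant[of X]]) (auto simp: X_def)
  qed (use summable_Psi in auto)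
  then show ?thesis by (simp add: Psi_def)
qed

lemma Psi_deriv_z: "((\<lambda>z. Psi b m l (r, z)) has_real_derivative Psi b m (Suc l) (r, z)) (at z)"
proof -
  \<comment> \<open>The factorials turn formal differentiation of the series into an index
    shift.\<close>
  have "diffs (\<lambda>j. psi b (j + l) m r / fact j) = (\<lambda>j. psi b (j + Suc l) m r / fact j)"
    by (simp add: diffs_def fun_eq_iff del: of_nat_Suc)
  then show ?thesis
    using termdiffs_strong_converges_everywhere[OF summable_Psi, of l m r z] by (simp add: Psi_def)
qed

text \<open>Coefficient by coefficient this is the last clause of \<open>psi\<close>.\<close>

lemma Psi_equation: "Psi b (Suc m) l z - Psi b m (l + 2) z + Psi b m (l + 3) z = 0"
proof -
  obtain r y where z: "z = (r, y)" by (cases z)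
  have "Psi b m (l + 2) z - Psi b (Suc m) l z
      = (\<Sum>j. psi b (j + (l + 2)) m r / fact j * y ^ j - psi b (j + l) (Suc m) r / fact j * y ^ j)"
    unfolding z Psi_def prod.case by (rule suminf_diff[OF summable_Psi summable_Psi])
  also have "\<dots> = Psi b m (l + 3) z"
    unfolding z Psi_def prod.case by (intro suminf_cong) (simp add: numeral_2_eq_2 numeral_3_eq_3 field_simps)
  finally show ?thesis by simp
qed

lemma Psi_at_0: "Psi b m l (r, 0) = psi b l m r"
  using powser_zero[of "\<lambda>j. psi b (j + l) m r / fact j"] by (simp add: Psi_def)

lemma Psi_support: "d \<le> \<bar>r\<bar> \<Longrightarrow> Psi b m l (r, z) = 0"
  by (simp add: Psi_def psi_support)

text \<open>The derivatives in \<open>q\<close> all fall on \<open>b\<close>, so that the cases \<open>a = 0\<close> (source at \<open>q = 0\<close>) and \<open>a = -Z\<close>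
  (no source in \<open>\<bar>q\<bar> < Z - d\<close>) differ only in the boundary term at \<open>a\<close>.\<close>

definition conv :: "real \<Rightarrow> real \<Rightarrow> nat \<Rightarrow> nat \<Rightarrow> real \<times> real \<Rightarrow> real" where
  "conv a Z m l = (\<lambda>(r, q). integral {a..Z} (\<lambda>z. b l (q - z) * Psi b m 0 (r, z)))"

lemma conv_integrand_continuous:
  "continuous_on A (\<lambda>(w, z). b l (snd w - z) * Psi b m 0 (fst w, z))"
  unfolding split_def
  by (intro continuous_intros continuous_on_compose2[OF b_continuous[of UNIV]]
      continuous_on_compose2[OF Psi_continuous]) auto

lemma conv_smooth_family: "smooth_family (conv a Z)"
  unfolding smooth_family_def
proof (intro allI conjI)
  fix m l r q
  show "continuous_on UNIV (conv a Z m l)"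
    using integral_continuous_on_param[of UNIV a Z "\<lambda>w z. b l (snd w - z) * Psi b m 0 (fst w, z)"]
      conv_integrand_continuous
    by (simp add: conv_def split_def)
  have int: "(\<lambda>z. b l (q - z) * Psi b m 0 (r, z)) integrable_on cbox a Z" for l q m r
    by (intro integrable_continuous continuous_intros continuous_on_compose2[OF b_continuous[of UNIV]]
      continuous_on_compose2[OF Psi_continuous]) auto
  have c1: "continuous_on A (\<lambda>(r, z). b l (q - z) * Psi b (Suc m) 0 (r, z))" for A
    unfolding split_def
    by (intro continuous_intros continuous_on_compose2[OF b_continuous[of UNIV]]
      continuous_on_compose2[OF Psi_continuous]) auto
  have c2: "continuous_on A (\<lambda>(q, z). b (Suc l) (q - z) * Psi b m 0 (r, z))" for A
    unfolding split_def
    by (intro continuous_intros continuous_on_compose2[OF b_continuous[of UNIV]]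
      continuous_on_compose2[OF Psi_continuous]) auto
  have "((\<lambda>r. integral (cbox a Z) (\<lambda>z. b l (q - z) * Psi b m 0 (r, z))) has_real_derivative
      integral (cbox a Z) (\<lambda>z. b l (q - z) * Psi b (Suc m) 0 (r, z))) (at r within UNIV)"
    by (rule leibniz_rule_field_derivative[OF _ int c1]) (auto intro!: DERIV_cmult Psi_deriv_t)
  then show "((\<lambda>s. conv a Z m l (s, q)) has_real_derivative conv a Z (Suc m) l (r, q)) (at r)"
    by (simp add: conv_def)
  have d: "((\<lambda>q. b l (q - z)) has_real_derivative b (Suc l) (q - z)) (at q)" for q z
  proof -
    have "((\<lambda>q. q - z) has_real_derivative 1) (at q)" by (auto intro!: derivative_eq_intros)
    from DERIV_chain'[OF this b_deriv] show ?thesis by simp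
  qed
  have "((\<lambda>q. integral (cbox a Z) (\<lambda>z. b l (q - z) * Psi b m 0 (r, z))) has_real_derivative
      integral (cbox a Z) (\<lambda>z. b (Suc l) (q - z) * Psi b m 0 (r, z))) (at q within UNIV)"
    by (rule leibniz_rule_field_derivative[OF _ int c2]) (auto intro!: DERIV_cmult_right d)
  then show "((\<lambda>q. conv a Z m l (r, q)) has_real_derivative conv a Z m (Suc l) (r, q)) (at q)"
    by (simp add: conv_def)
qed

text \<open>The boundary terms that arise when the derivatives are moved from \<open>b\<close> to \<open>Psi\<close> by parts.\<close>

definition flux :: "nat \<Rightarrow> real \<Rightarrow> real \<Rightarrow> real \<Rightarrow> real" where
  "flux l r q z = b (l + 1) (q - z) * Psi b 0 0 (r, z) + b l (q - z) * Psi b 0 1 (r, z)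
     - b (l + 2) (q - z) * Psi b 0 0 (r, z) - b (l + 1) (q - z) * Psi b 0 1 (r, z)
     - b l (q - z) * Psi b 0 2 (r, z)"

text \<open>Once the equation for \<open>Psi\<close> has replaced the time derivative, the integrand
  is the exact \<open>z\<close>-derivative of \<open>flux\<close>, so only the two end points
  contribute.\<close>

lemma conv_equation:
  assumes "a \<le> Z"
  shows "conv a Z 1 l (r, q) - conv a Z 0 (l + 2) (r, q) + conv a Z 0 (l + 3) (r, q)
    = flux l r q Z - flux l r q a"
proof -
  let ?g = "\<lambda>z. b l (q - z) * Psi b 1 0 (r, z) - b (l + 2) (q - z) * Psi b 0 0 (r, z)
     + b (l + 3) (q - z) * Psi b 0 0 (r, z)"
  have d: "((\<lambda>z. b k (q - z)) has_real_derivative - b (Suc k) (q - z)) (at z)" for k z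
  proof -
    have "((\<lambda>z. q - z) has_real_derivative -1) (at z)" by (auto intro!: derivative_eq_intros)
    from DERIV_chain'[OF this b_deriv] show ?thesis by simp
  qed
  have p: "((\<lambda>z. Psi b 0 k (r, z)) has_real_derivative Psi b 0 (Suc k) (r, z)) (at z)" for k z
    by (rule Psi_deriv_z)
  have eq: "Psi b (Suc 0) 0 w = Psi b 0 (Suc (Suc 0)) w - Psi b 0 (Suc (Suc (Suc 0))) w" for w
    using Psi_equation[of 0 0 w] by (simp add: numeral_2_eq_2 numeral_3_eq_3)
  have "(flux l r q has_real_derivative ?g z) (at z)" for z
    unfolding flux_def
    by (rule derivative_eq_intros d p refl)+ (simp add: eq algebra_simps numeral_2_eq_2 numeral_3_eq_3)
  then have "(?g has_integral flux l r q Z - flux l r q a) {a..Z}"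
    using assms
    by (intro fundamental_theorem_of_calculus)
       (auto simp flip: has_real_derivative_iff_has_vector_derivative intro: has_field_derivative_at_within)
  moreover have int: "(\<lambda>z. b l (q - z) * Psi b m 0 (r, z)) integrable_on {a..Z}" for l m
    by (intro integrable_continuous_interval continuous_intros continuous_on_compose2[OF b_continuous[of UNIV]]
      continuous_on_compose2[OF Psi_continuous]) auto
  have "(?g has_integral conv a Z 1 l (r, q) - conv a Z 0 (l + 2) (r, q) + conv a Z 0 (l + 3) (r, q)) {a..Z}"
    unfolding conv_def prod.case by (intro has_integral_add has_integral_diff integrable_integral int)
  ultimately show ?thesis by (rule has_integral_unique[symmetric])
qed

lemma flux_eq_0: "d \<le> \<bar>q - z\<bar> \<Longrightarrow> flux l r q z = 0"
  by (simp add: flux_def b_support)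

text \<open>The Cauchy data \<open>(0, 0, b)\<close> leave only the last term of
  \<open>flux\<close>. It enters \<open>conv_equation\<close> with a minus sign and becomes the
  source \<open>b 0 r * b 0 q\<close>.\<close>

lemma flux_at_0: "flux l r q 0 = - b l q * b 0 r"
  by (simp add: flux_def Psi_at_0 numeral_2_eq_2)

lemma conv_support_t: "d \<le> \<bar>r\<bar> \<Longrightarrow> conv a Z m l (r, q) = 0"
  by (simp add: conv_def Psi_support)

text \<open>For \<open>z\<close> in \<open>{0..Z}\<close> the argument \<open>q - z\<close> stays at
  or below \<open>-d\<close>, outside the support of \<open>b\<close>.\<close>

lemma conv_causal: "q \<le> - d \<Longrightarrow> conv 0 Z m l (r, q) = 0"
  unfolding conv_def prod.case by (rule integral_unique, rule has_integral_is_0) (auto simp: b_support)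

text \<open>For \<open>q\<close> at least \<open>d\<close>, the extra range \<open>{-Z..0}\<close>
  has \<open>q - z\<close> at least \<open>d\<close> and contributes nothing. To the right of the
  source the two choices of \<open>a\<close> are thus indistinguishable.\<close>

lemma conv_eq_entire:
  assumes "d \<le> q" "0 \<le> Z"
  shows "conv (-Z) Z m l (r, q) = conv 0 Z m l (r, q)"
proof -
  let ?f = "\<lambda>z. b l (q - z) * Psi b m 0 (r, z)"
  have "?f integrable_on {-Z..Z}"
    by (intro integrable_continuous_interval continuous_intros continuous_on_compose2[OF b_continuous[of UNIV]]
      continuous_on_compose2[OF Psi_continuous]) auto
  then have "integral {-Z..0} ?f + integral {0..Z} ?f = integral {-Z..Z} ?f"
    using assms by (intro Henstock_Kurzweil_Integration.integral_combine) auto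
  moreover have "integral {-Z..0} ?f = 0"
    by (rule integral_unique, rule has_integral_is_0) (use assms in \<open>auto simp: b_support\<close>)
  ultimately show ?thesis by (simp add: conv_def)
qed

end

section \<open>The weak formulation\<close>

lemma integral_derivative_eq_0:
  fixes h h' :: "real \<Rightarrow> real"
  assumes "\<And>t. (h has_real_derivative h' t) (at t)" "continuous_on UNIV h'"
    and "\<And>t. R \<le> \<bar>t\<bar> \<Longrightarrow> h t = 0" "\<And>t. R \<le> \<bar>t\<bar> \<Longrightarrow> h' t = 0" "0 < R"
  shows "(\<integral>t. h' t \<partial>lborel) = 0"
proof -
  have "(\<integral>t. h' t * indicator {-R..R} t \<partial>lborel) = h R - h (-R)"
    using assms by (intro integral_FTC_Icc_real) (auto simp: continuous_on_eq_continuous_at)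
  also have "(\<lambda>t. h' t * indicator {-R..R} t) = h'"
    using assms(4) by (force simp: fun_eq_iff indicator_def)
  finally show ?thesis using assms(3)[of R] assms(3)[of "-R"] \<open>0 < R\<close> by simp
qed

lemma integrable_continuous_support:
  fixes f :: "'a::euclidean_space \<Rightarrow> real"
  assumes "continuous_on UNIV f" "compact K" "\<And>z. z \<notin> K \<Longrightarrow> f z = 0"
  shows "integrable lborel f"
proof -
  have "integrable lborel (\<lambda>z. indicator K z *\<^sub>R f z)"
    using assms by (intro borel_integrable_compact) (auto intro: continuous_on_subset)
  also have "(\<lambda>z. indicator K z *\<^sub>R f z) = f"
    using assms(3) by (auto simp: fun_eq_iff indicator_def)
  finally show ?thesis .
qed

text \<open>By Fubini the differentiated variable is integrated first; on each line the compact
  support makes the integral vanish.\<close>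

lemma integral_partial_derivative_eq_0:
  fixes h g :: "real \<times> real \<Rightarrow> real"
  assumes g: "continuous_on UNIV g" and K: "compact K" "\<And>z. z \<notin> K \<Longrightarrow> h z = 0" "\<And>z. z \<notin> K \<Longrightarrow> g z = 0"
  shows "(\<And>t x. ((\<lambda>s. h (s, x)) has_real_derivative g (t, x)) (at t)) \<Longrightarrow> integral\<^sup>L lborel g = 0"
    and "(\<And>t x. ((\<lambda>y. h (t, y)) has_real_derivative g (t, x)) (at x)) \<Longrightarrow> integral\<^sup>L lborel g = 0"
proof -
  obtain R where R: "R > 0" "\<And>z. z \<in> K \<Longrightarrow> norm z < R"
    using compact_imp_bounded[OF K(1)] bounded_pos_less by blast
  have out: "(t, x) \<notin> K" if "R \<le> \<bar>t\<bar> \<or> R \<le> \<bar>x\<bar>" for t x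
    using R(2)[of "(t, x)"] that norm_fst_le[of "(t, x)"] norm_snd_le[of x t] norm_fst_le[of t x] by auto
  have int: "integrable lborel g"
    using integrable_continuous_support[OF g K(1,3)] .
  have c1: "continuous_on UNIV (\<lambda>t. g (t, x))" for x
    by (intro continuous_on_compose2[OF g] continuous_intros) auto
  have c2: "continuous_on UNIV (\<lambda>x. g (t, x))" for t
    by (intro continuous_on_compose2[OF g] continuous_intros) auto
  have int': "integrable (lborel \<Otimes>\<^sub>M lborel) (\<lambda>(t, x). g (t, x))"
    using int by (simp add: lborel_prod)
  show "integral\<^sup>L lborel g = 0"
    if d: "\<And>t x. ((\<lambda>s. h (s, x)) has_real_derivative g (t, x)) (at t)"
  proof -
    have "(\<integral>t. g (t, x) \<partial>lborel) = 0" for x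
      by (rule integral_derivative_eq_0[OF d c1 _ _ R(1)]) (auto simp: K out)
    then show ?thesis
      using lborel_pair.integral_snd[OF int'] by (simp add: lborel_prod)
  qed
  show "integral\<^sup>L lborel g = 0"
    if d: "\<And>t x. ((\<lambda>y. h (t, y)) has_real_derivative g (t, x)) (at x)"
  proof -
    have "(\<integral>x. g (t, x) \<partial>lborel) = 0" for t
      by (rule integral_derivative_eq_0[OF d c2 _ _ R(1)]) (auto simp: K out)
    then show ?thesis
      using lborel_pair.integral_fst[OF int'] by (simp add: lborel_prod)
  qed
qed

lemma partial_eq_0_outside:
  assumes "closed K" "\<And>z. z \<notin> K \<Longrightarrow> \<phi> z = 0" "z \<notin> K"
  shows "partial_t \<phi> z = 0" "partial_x \<phi> z = 0"
proof -
  obtain t x where z: "z = (t, x)" by (cases z)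
  have "open ((\<lambda>s. (s, x)) -` (- K))" "open ((\<lambda>y. (t, y)) -` (- K))"
    using assms(1) by (auto intro!: open_vimage continuous_intros)
  moreover have "t \<in> (\<lambda>s. (s, x)) -` (- K)" "x \<in> (\<lambda>y. (t, y)) -` (- K)"
    using assms(3) by (simp_all add: z)
  ultimately have "eventually (\<lambda>s. s \<in> (\<lambda>s. (s, x)) -` (- K)) (nhds t)"
    "eventually (\<lambda>y. y \<in> (\<lambda>y. (t, y)) -` (- K)) (nhds x)"
    using eventually_nhds_in_open by blast+
  then have e: "eventually (\<lambda>s. \<phi> (s, x) = 0) (nhds t)" "eventually (\<lambda>y. \<phi> (t, y) = 0) (nhds x)"
    by (auto elim!: eventually_mono intro: assms(2))
  show "partial_t \<phi> z = 0" "partial_x \<phi> z = 0"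
    using deriv_cong_ev[OF e(1) refl] deriv_cong_ev[OF e(2) refl] by (simp_all add: z partial_t_def partial_x_def)
qed

lemma test_functionsI:
  assumes "\<And>k. C_k k \<phi>" "compact K" "K \<subseteq> \<Omega>" "\<And>z. z \<notin> K \<Longrightarrow> \<phi> z = 0"
  shows "\<phi> \<in> test_functions \<Omega>"
proof -
  have *: "closure {z. \<phi> z \<noteq> 0} \<subseteq> K"
    using assms(2,4) by (intro closure_minimal compact_imp_closed) auto
  then have "compact (closure {z. \<phi> z \<noteq> 0})"
    using compact_Int_closed[OF assms(2) closed_closure[of "{z. \<phi> z \<noteq> 0}"]] by (simp add: Int_absorb1)
  then show ?thesis
    using assms(1,3) * by (auto simp: test_functions_def)
qed

text \<open>Minus the formal adjoint of \<open>\<partial>\<^sub>t - \<partial>\<^sub>x\<^sup>2 + \<partial>\<^sub>x\<^sup>3\<close>.\<close>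

definition kdvb_dual :: "(real \<times> real \<Rightarrow> real) \<Rightarrow> real \<times> real \<Rightarrow> real" where
  "kdvb_dual \<phi> = (\<lambda>z. partial_t \<phi> z + partial_x (partial_x \<phi>) z + partial_x (partial_x (partial_x \<phi>)) z)"

lemma test_function_support:
  assumes "\<phi> \<in> test_functions \<Omega>"
  shows "\<exists>K. compact K \<and> K \<subseteq> \<Omega> \<and> (\<forall>z. z \<notin> K \<longrightarrow> \<phi> z = 0 \<and> partial_t \<phi> z = 0 \<and> partial_x \<phi> z = 0 \<and>
    partial_x (partial_x \<phi>) z = 0 \<and> partial_x (partial_x (partial_x \<phi>)) z = 0)"
proof -
  let ?K = "closure {z. \<phi> z \<noteq> 0}"
  have 0: "\<phi> z = 0" if "z \<notin> ?K" for z
    using that closure_subset[of "{z. \<phi> z \<noteq> 0}"] by auto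
  have 1: "partial_x \<phi> z = 0" "partial_t \<phi> z = 0" if "z \<notin> ?K" for z
    using partial_eq_0_outside[OF closed_closure 0 that] by auto
  have 2: "partial_x (partial_x \<phi>) z = 0" if "z \<notin> ?K" for z
    using partial_eq_0_outside(2)[OF closed_closure 1(1) that] .
  have 3: "partial_x (partial_x (partial_x \<phi>)) z = 0" if "z \<notin> ?K" for z
    using partial_eq_0_outside(2)[OF closed_closure 2 that] .
  have "compact ?K" "?K \<subseteq> \<Omega>"
    using assms by (simp_all add: test_functions_def)
  then show ?thesis
    using 0 1 2 3 by (intro exI[of _ ?K] conjI allI impI)
qed

lemma test_function_continuous:
  assumes "\<phi> \<in> test_functions \<Omega>"
  shows "continuous_on UNIV \<phi>" "continuous_on UNIV (partial_t \<phi>)" "continuous_on UNIV (partial_x \<phi>)"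
    "continuous_on UNIV (partial_x (partial_x \<phi>))" "continuous_on UNIV (partial_x (partial_x (partial_x \<phi>)))"
proof -
  have C: "C_k k \<phi>" for k using assms by (simp add: test_functions_def)
  show "continuous_on UNIV \<phi>" "continuous_on UNIV (partial_t \<phi>)" "continuous_on UNIV (partial_x \<phi>)"
    "continuous_on UNIV (partial_x (partial_x \<phi>))" "continuous_on UNIV (partial_x (partial_x (partial_x \<phi>)))"
    using C[of 0] C[of "Suc 0"] C[of "Suc (Suc 0)"] C[of "Suc (Suc (Suc 0))"] by simp_all
qed

text \<open>All integrations by parts are done at once: \<open>?g1\<close> is the
  \<open>t\<close>-derivative of \<open>E 0 0 z * \<phi> z\<close> and \<open>?g2\<close> is the
  \<open>x\<close>-derivative of \<open>?h2\<close>. The sum of the two is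
  \<open>E 0 0 z * kdvb_dual \<phi> z\<close> plus \<open>\<phi> z\<close> times the equation for
  \<open>E\<close>, which is available on the support of \<open>\<phi>\<close>.\<close>

lemma classical_imp_weak:
  assumes E: "smooth_family E" and \<phi>: "\<phi> \<in> test_functions \<Omega>"
    and eq: "\<And>z. z \<in> \<Omega> \<Longrightarrow> E 1 0 z - E 0 2 z + E 0 3 z = 0"
  shows "(\<integral>z. E 0 0 z * kdvb_dual \<phi> z \<partial>lborel) = 0"
proof -
  obtain K where K0: "compact K" "K \<subseteq> \<Omega>" "\<forall>z. z \<notin> K \<longrightarrow> \<phi> z = 0 \<and> partial_t \<phi> z = 0 \<and> partial_x \<phi> z = 0 \<and>
    partial_x (partial_x \<phi>) z = 0 \<and> partial_x (partial_x (partial_x \<phi>)) z = 0"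
    using test_function_support[OF \<phi>] by blast
  then have K: "compact K" "K \<subseteq> \<Omega>" "\<And>z. z \<notin> K \<Longrightarrow> \<phi> z = 0" "\<And>z. z \<notin> K \<Longrightarrow> partial_t \<phi> z = 0"
    "\<And>z. z \<notin> K \<Longrightarrow> partial_x \<phi> z = 0" "\<And>z. z \<notin> K \<Longrightarrow> partial_x (partial_x \<phi>) z = 0"
    "\<And>z. z \<notin> K \<Longrightarrow> partial_x (partial_x (partial_x \<phi>)) z = 0"
    by blast+
  note c = test_function_continuous[OF \<phi>] smooth_familyD(1)[OF E]
  define p where "p = partial_x \<phi>"
  define q where "q = partial_x p"
  define r where "r = partial_x q"
  have C: "C_k k \<phi>" for k using \<phi> by (simp add: test_functions_def)
  have diff: "\<phi> differentiable (at z)" "p differentiable (at z)" "q differentiable (at z)" for z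
    using C[of "Suc (Suc (Suc 0))"] by (simp_all add: p_def q_def del: split_paired_All)
  note d = differentiable_imp_partials(2)[OF diff(1), folded p_def]
    differentiable_imp_partials(2)[OF diff(2), folded q_def]
    differentiable_imp_partials(2)[OF diff(3), folded r_def]
  note c' = c[folded p_def, folded q_def, folded r_def]
  note K' = K[folded p_def, folded q_def, folded r_def]
  let ?g1 = "\<lambda>z. E 0 0 z * partial_t \<phi> z + \<phi> z * E 1 0 z"
  let ?h2 = "\<lambda>z. E 0 0 z * p z - E 0 1 z * \<phi> z + E 0 0 z * q z - E 0 1 z * p z + E 0 2 z * \<phi> z"
  let ?g2 = "\<lambda>z. E 0 0 z * q z - E 0 2 z * \<phi> z + E 0 0 z * r z + E 0 3 z * \<phi> z"
  have g1: "integral\<^sup>L lborel ?g1 = 0"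
  proof (rule integral_partial_derivative_eq_0(1)[where h = "\<lambda>z. E 0 0 z * \<phi> z" and K = K])
    show "((\<lambda>s. E 0 0 (s, x) * \<phi> (s, x)) has_real_derivative ?g1 (t, x)) (at t)" for t x
      using DERIV_mult[OF smooth_familyD(2)[OF E, of 0 0 x t] differentiable_imp_partials(1)[OF diff(1)]]
      by (simp add: algebra_simps)
  qed (auto intro!: continuous_intros c simp: K)
  have g2: "integral\<^sup>L lborel ?g2 = 0"
  proof (rule integral_partial_derivative_eq_0(2)[where h = ?h2 and K = K])
    show "((\<lambda>y. ?h2 (t, y)) has_real_derivative ?g2 (t, x)) (at x)" for t x
      by (rule derivative_eq_intros smooth_familyD(3)[OF E] d refl)+
         (simp add: algebra_simps numeral_2_eq_2 numeral_3_eq_3)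
  qed (auto intro!: continuous_intros c' simp: K')
  have "integrable lborel ?g1" "integrable lborel ?g2"
    by (rule integrable_continuous_support[OF _ K(1)]; auto intro!: continuous_intros c c' simp: K K')+
  then have "(\<integral>z. ?g1 z + ?g2 z \<partial>lborel) = 0"
    using g1 g2 by simp
  moreover have "?g1 z + ?g2 z = E 0 0 z * kdvb_dual \<phi> z" for z
  proof (cases "z \<in> K")
    case True
    then have e: "E 1 0 z = E 0 2 z - E 0 3 z" using eq[of z] K(2) by auto
    have "?g1 z + ?g2 z = E 0 0 z * (partial_t \<phi> z + q z + r z)"
      unfolding e by (simp add: algebra_simps)
    then show ?thesis by (simp add: kdvb_dual_def p_def q_def r_def)
  next
    case False
    then show ?thesis by (simp add: kdvb_dual_def K K')
  qed
  ultimately show ?thesis by simp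
qed

section \<open>A smooth cutoff in one variable\<close>

lemma ex_smooth_step:
  assumes "0 < d" "d < 1"
  obtains X :: "nat \<Rightarrow> real \<Rightarrow> real" where
    "\<And>k x. (X k has_real_derivative X (Suc k) x) (at x)"
    "\<And>k x. x \<le> - d \<Longrightarrow> X k x = 0" "\<And>x. d \<le> x \<Longrightarrow> X 0 x = 1" "\<And>k x. d \<le> x \<Longrightarrow> X (Suc k) x = 0"
proof -
  obtain b :: "nat \<Rightarrow> real \<Rightarrow> real" and C where b:
    "\<And>k x. (b k has_real_derivative b (Suc k) x) (at x)"
    "\<And>k x. d \<le> \<bar>x\<bar> \<Longrightarrow> b k x = 0" "(b 0 has_integral 1) {-d..d}"
    using ex_gevrey_mollifier[OF assms(1)] by metis
  have cont: "continuous_on A (b 0)" for A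
    using DERIV_isCont[OF b(1)] by (simp add: continuous_at_imp_continuous_on)
  \<comment> \<open>As \<open>d < 1\<close>, the lower limit -1 lies to the left of the support of
    \<open>b 0\<close>.\<close>
  define I where "I x = integral {-1..x} (b 0)" for x
  have I0: "I x = 0" if "x \<le> - d" for x
    unfolding I_def by (rule integral_unique, rule has_integral_is_0) (use that assms in \<open>auto simp: b(2)\<close>)
  have I1: "I x = 1" if "d \<le> x" for x
  proof -
    have "(b 0 has_integral 1) {-1..x}"
      by (rule has_integral_on_superset[OF b(3)]) (use that assms in \<open>auto simp: b(2)\<close>)
    then show ?thesis by (simp add: I_def integral_unique)
  qed
  \<comment> \<open>The fundamental theorem needs \<open>x\<close> to the right of the lower limit
    -1; further left \<open>I\<close> is locally zero.\<close>
  have dI: "(I has_real_derivative b 0 x) (at x)" for x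
  proof (cases "x < - d")
    case True
    have "((\<lambda>x. 0) has_real_derivative 0) (at x)" by simp
    moreover have "eventually (\<lambda>y. 0 = I y) (nhds x)"
      using eventually_nhds_in_open[of "{..< - d}" x] True by (auto elim!: eventually_mono simp: I0)
    ultimately have "(I has_real_derivative 0) (at x)"
      using DERIV_cong_ev[of x x "\<lambda>x. 0" I 0 0] by simp
    then show ?thesis using True b(2)[of x 0] by simp
  next
    case False
    have "(I has_real_derivative b 0 x) (at x within {-1..x+1})"
      unfolding I_def[abs_def] using False assms by (intro integral_has_real_derivative cont) auto
    then show ?thesis
      using False assms at_within_interior[of x "{-1..x+1}"] by (simp add: interior_atLeastAtMost_real)
  qed
  show ?thesis
  proof (rule that[of "\<lambda>k. case k of 0 \<Rightarrow> I | Suc k \<Rightarrow> b k"])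
  qed (auto simp: b I0 I1 dI split: nat.split)
qed

section \<open>Essential support and integrability\<close>

lemma AE_zero_outside_ess_support:
  assumes "ess_support \<Omega> u \<subseteq> S"
  shows "AE z in lborel. z \<in> \<Omega> - S \<longrightarrow> u z = 0"
proof -
  let ?F = "{W. open W \<and> W \<subseteq> \<Omega> \<and> (AE z in lborel. z \<in> W \<longrightarrow> u z = 0)}"
  \<comment> \<open>A union over arbitrarily many open sets could accumulate exceptional null sets;
    Lindelof reduces it to countably many.\<close>
  obtain F' where F': "F' \<subseteq> ?F" "countable F'" "\<Union>F' = \<Union>?F"
    using Lindelof[of ?F] by auto
  have "AE z in lborel. \<forall>W\<in>F'. z \<in> W \<longrightarrow> u z = 0"
    using F' by (subst AE_ball_countable) auto
  moreover have "\<Omega> - S \<subseteq> \<Union>F'"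
    using assms F'(3) by (auto simp: ess_support_def)
  ultimately show ?thesis
    by (auto elim!: eventually_mono)
qed

lemma ess_support_subset:
  assumes "open \<Omega>" "closed S" "\<And>z. z \<in> \<Omega> - S \<Longrightarrow> u z = 0"
  shows "ess_support \<Omega> u \<subseteq> S"
proof -
  have "\<Omega> - S \<in> {W. open W \<and> W \<subseteq> \<Omega> \<and> (AE z in lborel. z \<in> W \<longrightarrow> u z = 0)}"
    using assms by auto
  then show ?thesis unfolding ess_support_def by blast
qed

lemma set_integrable_mult_bounded:
  fixes u g :: "'a \<Rightarrow> real"
  assumes u: "set_integrable M A u" and g: "g \<in> borel_measurable M" and "\<And>z. z \<in> A \<Longrightarrow> \<bar>g z\<bar> \<le> B"
  shows "set_integrable M A (\<lambda>z. u z * g z)"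
proof -
  have "integrable M (\<lambda>z. indicator A z *\<^sub>R (u z * g z))"
  proof (rule Bochner_Integration.integrable_bound)
    show "integrable M (\<lambda>z. B * (indicator A z *\<^sub>R u z))"
      using u by (intro integrable_mult_right) (simp add: set_integrable_def)
    have "(\<lambda>z. indicator A z *\<^sub>R u z) \<in> borel_measurable M"
      using u by (auto simp: set_integrable_def)
    then have "(\<lambda>z. (indicator A z *\<^sub>R u z) * g z) \<in> borel_measurable M"
      using g by (rule borel_measurable_times)
    then show "(\<lambda>z. indicator A z *\<^sub>R (u z * g z)) \<in> borel_measurable M"
      by (simp add: mult.assoc)
    have "\<bar>u z * g z\<bar> \<le> \<bar>B\<bar> * \<bar>u z\<bar>" if "z \<in> A" for z
    proof -
      have "\<bar>g z\<bar> \<le> \<bar>B\<bar>" using assms(3)[OF that] by simp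
      then show ?thesis using mult_right_mono[of "\<bar>g z\<bar>" "\<bar>B\<bar>" "\<bar>u z\<bar>"] by (simp add: abs_mult mult.commute)
    qed
    then show "AE z in M. norm (indicator A z *\<^sub>R (u z * g z)) \<le> norm (B * (indicator A z *\<^sub>R u z))"
      by (auto simp: indicator_def abs_mult)
  qed
  then show ?thesis by (simp add: set_integrable_def)
qed

text \<open>A bounded set has finite measure, and
  \<open>\<bar>x\<bar> \<le> 1 + x\<^sup>2\<close>.\<close>

lemma L2_imp_set_integrable:
  assumes "u \<in> L2_space \<Omega>" "\<Omega> \<in> sets borel" "bounded \<Omega>"
  shows "set_integrable lborel \<Omega> u"
  unfolding set_integrable_def
proof (rule Bochner_Integration.integrable_bound)
  have "integrable lborel (indicator \<Omega> :: real \<times> real \<Rightarrow> real)"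
    using assms(2) emeasure_bounded_finite[OF assms(3)] by (intro integrable_real_indicator) auto
  then show "integrable lborel (\<lambda>z. indicator \<Omega> z + indicator \<Omega> z *\<^sub>R (u z)\<^sup>2)"
    using assms(1) by (auto simp: L2_space_def set_integrable_def)
  show "(\<lambda>z. indicator \<Omega> z *\<^sub>R u z) \<in> borel_measurable lborel"
    using assms(1) by (simp add: L2_space_def set_borel_measurable_def)
  have "\<bar>x\<bar> \<le> 1 + x\<^sup>2" for x :: real
    using sum_squares_bound[of 1 "\<bar>x\<bar>"] by simp
  then show "AE z in lborel. norm (indicator \<Omega> z *\<^sub>R u z) \<le> norm (indicator \<Omega> z + indicator \<Omega> z *\<^sub>R (u z)\<^sup>2)"
    by (auto simp: indicator_def)
qed

text \<open>Moving the derivatives to the test function gives all three terms a minus sign, which is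
  why \<open>kdvb_dual\<close> has only plus signs. Each derivative of \<open>\<phi>\<close> is
  bounded, so the three integrals exist separately and merge into one.\<close>

lemma solves_KdVB_iff:
  assumes "set_integrable lborel \<Omega> u"
  shows "solves_KdVB \<Omega> u \<longleftrightarrow>
    (\<forall>\<phi> \<in> test_functions \<Omega>. set_lebesgue_integral lborel \<Omega> (\<lambda>z. u z * kdvb_dual \<phi> z) = 0)"
  unfolding solves_KdVB_def
proof (rule ball_cong[OF refl])
  fix \<phi> assume \<phi>: "\<phi> \<in> test_functions \<Omega>"
  obtain K where K0: "compact K" "K \<subseteq> \<Omega>" "\<forall>z. z \<notin> K \<longrightarrow> \<phi> z = 0 \<and> partial_t \<phi> z = 0 \<and> partial_x \<phi> z = 0 \<and>
    partial_x (partial_x \<phi>) z = 0 \<and> partial_x (partial_x (partial_x \<phi>)) z = 0"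
    using test_function_support[OF \<phi>] by blast
  then have K: "compact K" "K \<subseteq> \<Omega>" "\<And>z. z \<notin> K \<Longrightarrow> \<phi> z = 0" "\<And>z. z \<notin> K \<Longrightarrow> partial_t \<phi> z = 0"
    "\<And>z. z \<notin> K \<Longrightarrow> partial_x \<phi> z = 0" "\<And>z. z \<notin> K \<Longrightarrow> partial_x (partial_x \<phi>) z = 0"
    "\<And>z. z \<notin> K \<Longrightarrow> partial_x (partial_x (partial_x \<phi>)) z = 0"
    by blast+
  have int: "set_integrable lborel \<Omega> (\<lambda>z. u z * g z)"
    if g: "continuous_on UNIV g" "\<And>z. z \<notin> K \<Longrightarrow> g z = 0" for g
  proof -
    have "bounded (g ` K)"
      using K(1) g(1) by (intro compact_imp_bounded compact_continuous_image) (auto intro: continuous_on_subset)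
    then obtain B where B: "\<And>z. z \<in> K \<Longrightarrow> \<bar>g z\<bar> \<le> B"
      by (auto simp: bounded_iff)
    then have "\<bar>g z\<bar> \<le> max 0 B" for z using g(2) by (cases "z \<in> K") fastforce+
    moreover have "g \<in> borel_measurable lborel" using g(1) by (simp add: borel_measurable_continuous_onI)
    ultimately show ?thesis using set_integrable_mult_bounded[OF assms] by blast
  qed
  note c = test_function_continuous[OF \<phi>]
  note i = int[OF c(2) K(4)] int[OF c(4) K(6)] int[OF c(5) K(7)]
  have "set_lebesgue_integral lborel \<Omega> (\<lambda>z. u z * kdvb_dual \<phi> z)
     = dist_of \<Omega> u (partial_t \<phi>) + dist_of \<Omega> u (partial_x (partial_x \<phi>))
       + dist_of \<Omega> u (partial_x (partial_x (partial_x \<phi>)))"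
    using i set_integral_add(1)[OF i(1,2)]
    by (simp add: kdvb_dual_def dist_of_def distrib_left set_integral_add)
  then show "(dist_t (dist_of \<Omega> u) \<phi> - dist_x (dist_x (dist_of \<Omega> u)) \<phi>
       + dist_x (dist_x (dist_x (dist_of \<Omega> u))) \<phi> = 0)
    \<longleftrightarrow> set_lebesgue_integral lborel \<Omega> (\<lambda>z. u z * kdvb_dual \<phi> z) = 0"
    by (auto simp: dist_t_def dist_x_def)
qed

section \<open>Mollification in \<open>L\<^sup>2\<close>\<close>

lemma nn_integral_lborel_translate:
  fixes f :: "'a::euclidean_space \<Rightarrow> ennreal"
  assumes "f \<in> borel_measurable borel"
  shows "(\<integral>\<^sup>+z. f (z - h) \<partial>lborel) = (\<integral>\<^sup>+z. f z \<partial>lborel)"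
proof -
  have "(\<integral>\<^sup>+z. f z \<partial>lborel) = (\<integral>\<^sup>+z. f z \<partial>distr lborel borel ((+) (- h)))"
    by (simp add: lborel_distr_plus)
  also have "\<dots> = (\<integral>\<^sup>+z. f (- h + z) \<partial>lborel)"
    using assms by (intro nn_integral_distr) auto
  finally show ?thesis by simp
qed

lemma square_add_le: "(a + b)\<^sup>2 \<le> 2 * a\<^sup>2 + 2 * (b::real)\<^sup>2"
  using zero_le_power2[of "a - b"] by (simp add: power2_eq_square algebra_simps)

section \<open>Continuous approximation and continuity of translations\<close>

lemma L2_approx_bounded:
  fixes U :: "'a::euclidean_space \<Rightarrow> real"
  assumes U[measurable]: "U \<in> borel_measurable borel" and fin: "(\<integral>\<^sup>+z. ennreal ((U z)\<^sup>2) \<partial>lborel) < \<infinity>"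
    and "0 < e"
  shows "\<exists>M\<ge>0. (\<integral>\<^sup>+z. ennreal ((U z - max (- M) (min M (U z)))\<^sup>2) \<partial>lborel) < ennreal e"
proof -
  let ?F = "\<lambda>(n::nat) z. ennreal ((U z - max (- real n) (min (real n) (U z)))\<^sup>2)"
  have "(\<lambda>n. \<integral>\<^sup>+z. ?F n z \<partial>lborel) \<longlonglongrightarrow> (\<integral>\<^sup>+z. 0 \<partial>(lborel :: 'a measure))"
  proof (rule nn_integral_dominated_convergence[where w = "\<lambda>z. ennreal ((U z)\<^sup>2)"])
    show "AE z in lborel. ?F n z \<le> ennreal ((U z)\<^sup>2)" for n
      by (intro always_eventually allI ennreal_leI) (auto simp: abs_le_square_iff[symmetric] max_def min_def)
    show "AE z in lborel. (\<lambda>n. ?F n z) \<longlonglongrightarrow> 0"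
    proof (rule always_eventually, rule allI)
      fix z
      obtain m :: nat where m: "\<bar>U z\<bar> \<le> real m" using real_arch_simple by blast
      have "\<forall>\<^sub>F n in sequentially. ?F n z = 0"
        using eventually_ge_at_top[of m]
      proof eventually_elim
        case (elim n)
        then have "\<bar>U z\<bar> \<le> real n" using m by linarith
        then have "max (- real n) (min (real n) (U z)) = U z" by linarith
        then show ?case by simp
      qed
      then show "(\<lambda>n. ?F n z) \<longlonglongrightarrow> 0" by (rule tendsto_eventually)
    qed
  qed (use fin in auto)
  then have "(\<lambda>n. \<integral>\<^sup>+z. ?F n z \<partial>lborel) \<longlonglongrightarrow> 0" by simp
  then have "\<forall>\<^sub>F n in sequentially. (\<integral>\<^sup>+z. ?F n z \<partial>lborel) < ennreal e"
    using assms(3) by (intro order_tendstoD(2)) auto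
  then obtain n where "(\<integral>\<^sup>+z. ?F n z \<partial>lborel) < ennreal e"
    by (auto simp: eventually_sequentially)
  then show ?thesis by (intro exI[of _ "real n"]) simp
qed

text \<open>A measurable function is an almost everywhere limit of continuous ones. Clamping these
  to the bound of \<open>U\<close> and cutting them off outside a ball provides a constant on that
  ball as dominating function.\<close>

lemma L2_approx_continuous_bounded:
  fixes U :: "'a::euclidean_space \<Rightarrow> real"
  assumes U[measurable]: "U \<in> borel_measurable borel" and M: "\<And>z. \<bar>U z\<bar> \<le> M"
    and R: "\<And>z. R < norm z \<Longrightarrow> U z = 0" and "0 < e"
  shows "\<exists>g. continuous_on UNIV g \<and> (\<forall>z. R + 1 \<le> norm z \<longrightarrow> g z = 0) \<and>
    (\<integral>\<^sup>+z. ennreal ((U z - g z)\<^sup>2) \<partial>lborel) < ennreal e"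
proof -
  have "U \<in> borel_measurable lebesgue"
    using U by (simp add: measurable_completion)
  then have "U measurable_on UNIV"
    by (intro lebesgue_measurable_imp_measurable_on) auto
  then obtain N g where N: "negligible N" and g: "\<And>n. continuous_on UNIV (g n)"
    "\<And>z. z \<notin> N \<Longrightarrow> (\<lambda>n. g n z) \<longlonglongrightarrow> U z"
    unfolding measurable_on_def by auto
  \<comment> \<open>The cutoff is 1 wherever \<open>U\<close> may be nonzero, so multiplying by it
    leaves the limit unchanged.\<close>
  define \<kappa> :: "'a \<Rightarrow> real" where "\<kappa> z = max 0 (min 1 (R + 1 - norm z))" for z
  define G where "G n z = \<kappa> z * max (- M) (min M (g n z))" for n :: nat and z
  have M0: "0 \<le> M" using M[of 0] by simp
  have \<kappa>: "0 \<le> \<kappa> z" "\<kappa> z \<le> 1" "norm z \<le> R \<Longrightarrow> \<kappa> z = 1" "R + 1 \<le> norm z \<Longrightarrow> \<kappa> z = 0" for z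
    by (auto simp: \<kappa>_def)
  have Gc: "continuous_on UNIV (G n)" for n
    unfolding G_def \<kappa>_def by (intro continuous_intros g)
  then have [measurable]: "G n \<in> borel_measurable borel" for n
    by (rule borel_measurable_continuous_onI)
  have \<kappa>U: "\<kappa> z * U z = U z" for z using R[of z] \<kappa>(3)[of z] by (cases "norm z \<le> R") auto
  have clamp: "\<bar>max (- M) (min M y)\<bar> \<le> M" for y using M0 by auto
  have "(\<lambda>n. \<integral>\<^sup>+z. ennreal ((U z - G n z)\<^sup>2) \<partial>lborel) \<longlonglongrightarrow> (\<integral>\<^sup>+z. 0 \<partial>(lborel :: 'a measure))"
  proof (rule nn_integral_dominated_convergence[where w = "\<lambda>z. ennreal ((2 * M)\<^sup>2) * indicator (cball 0 (R + 1)) z"])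
    show "(\<integral>\<^sup>+z. ennreal ((2 * M)\<^sup>2) * indicator (cball 0 (R + 1)) z \<partial>(lborel :: 'a measure)) < \<infinity>"
      using emeasure_bounded_finite[of "cball (0::'a) (R + 1)"]
      by (simp add: nn_integral_cmult_indicator ennreal_mult_less_top)
    show "(\<lambda>z. ennreal ((2 * M)\<^sup>2) * indicator (cball 0 (R + 1)) z) \<in> borel_measurable (lborel :: 'a measure)"
      by (intro borel_measurable_times_ennreal borel_measurable_const borel_measurable_indicator) auto
    show "AE z in lborel. ennreal ((U z - G n z)\<^sup>2) \<le> ennreal ((2 * M)\<^sup>2) * indicator (cball 0 (R + 1)) z" for n
    proof (intro always_eventually allI)
      fix z
      show "ennreal ((U z - G n z)\<^sup>2) \<le> ennreal ((2 * M)\<^sup>2) * indicator (cball 0 (R + 1)) z"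
      proof (cases "norm z \<le> R + 1")
        case True
        have "\<bar>G n z\<bar> \<le> 1 * M"
          unfolding G_def abs_mult using \<kappa>[of z] by (intro mult_mono clamp) auto
        then have "\<bar>U z - G n z\<bar> \<le> 2 * M" using M[of z] by linarith
        then have "(U z - G n z)\<^sup>2 \<le> (2 * M)\<^sup>2"
          by (intro abs_le_square_iff[THEN iffD1]) simp
        from ennreal_leI[OF this] show ?thesis
          using True by simp
      next
        case False
        then have "U z = 0" "G n z = 0" using R[of z] \<kappa>(4)[of z] by (auto simp: G_def)
        then show ?thesis by simp
      qed
    qed
    have "AE z in lborel. z \<notin> N"
      using N AE_not_in[of N lebesgue] by (simp add: negligible_iff_null_sets AE_completion_iff)
    then show "AE z in lborel. (\<lambda>n. ennreal ((U z - G n z)\<^sup>2)) \<longlonglongrightarrow> 0"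
    proof eventually_elim
      case (elim z)
      have "(\<lambda>n. (U z - G n z)\<^sup>2) \<longlonglongrightarrow> (U z - \<kappa> z * max (- M) (min M (U z)))\<^sup>2"
        unfolding G_def by (intro tendsto_intros g(2) elim)
      moreover have "max (- M) (min M (U z)) = U z" using M[of z] by linarith
      ultimately have "(\<lambda>n. (U z - G n z)\<^sup>2) \<longlonglongrightarrow> 0" by (simp add: \<kappa>U)
      then show ?case by (metis ennreal_0 tendsto_ennrealI)
    qed
  qed auto
  then have "(\<lambda>n. \<integral>\<^sup>+z. ennreal ((U z - G n z)\<^sup>2) \<partial>lborel) \<longlonglongrightarrow> 0" by simp
  then have "\<forall>\<^sub>F n in sequentially. (\<integral>\<^sup>+z. ennreal ((U z - G n z)\<^sup>2) \<partial>lborel) < ennreal e"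
    using assms(4) by (intro order_tendstoD(2)) auto
  then obtain n where "(\<integral>\<^sup>+z. ennreal ((U z - G n z)\<^sup>2) \<partial>lborel) < ennreal e"
    by (auto simp: eventually_sequentially)
  then show ?thesis
    using Gc \<kappa>(4) by (intro exI[of _ "G n"]) (auto simp: G_def)
qed

text \<open>Stands in for the triangle inequality of the norm; the price is a factor two on the
  squares.\<close>

lemma nn_integral_square_add_le:
  fixes f g :: "'a::euclidean_space \<Rightarrow> real"
  assumes [measurable]: "f \<in> borel_measurable borel" "g \<in> borel_measurable borel"
    and "(\<integral>\<^sup>+z. ennreal ((f z)\<^sup>2) \<partial>lborel) \<le> ennreal a" "(\<integral>\<^sup>+z. ennreal ((g z)\<^sup>2) \<partial>lborel) \<le> ennreal b"
    and "0 \<le> a" "0 \<le> b"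
  shows "(\<integral>\<^sup>+z. ennreal ((f z + g z)\<^sup>2) \<partial>lborel) \<le> ennreal (2 * a + 2 * b)"
proof -
  have "(\<integral>\<^sup>+z. ennreal ((f z + g z)\<^sup>2) \<partial>lborel) \<le> (\<integral>\<^sup>+z. 2 * ennreal ((f z)\<^sup>2) + 2 * ennreal ((g z)\<^sup>2) \<partial>lborel)"
  proof (rule nn_integral_mono)
    fix z
    have "ennreal ((f z + g z)\<^sup>2) \<le> ennreal (2 * (f z)\<^sup>2 + 2 * (g z)\<^sup>2)"
      by (intro ennreal_leI square_add_le)
    then show "ennreal ((f z + g z)\<^sup>2) \<le> 2 * ennreal ((f z)\<^sup>2) + 2 * ennreal ((g z)\<^sup>2)"
      by (simp add: ennreal_plus ennreal_mult)
  qed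
  also have "\<dots> = 2 * (\<integral>\<^sup>+z. ennreal ((f z)\<^sup>2) \<partial>lborel) + 2 * (\<integral>\<^sup>+z. ennreal ((g z)\<^sup>2) \<partial>lborel)"
    by (simp add: nn_integral_add nn_integral_cmult)
  also have "\<dots> \<le> 2 * ennreal a + 2 * ennreal b"
    by (intro add_mono mult_left_mono assms) auto
  also have "\<dots> = ennreal (2 * a + 2 * b)"
    using assms(5,6) by (simp add: ennreal_plus ennreal_mult)
  finally show ?thesis .
qed

lemma L2_approx_continuous:
  fixes U :: "'a::euclidean_space \<Rightarrow> real"
  assumes U[measurable]: "U \<in> borel_measurable borel" and fin: "(\<integral>\<^sup>+z. ennreal ((U z)\<^sup>2) \<partial>lborel) < \<infinity>"
    and R: "\<And>z. R < norm z \<Longrightarrow> U z = 0" and "0 < e"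
  shows "\<exists>g. continuous_on UNIV g \<and> (\<forall>z. R + 1 \<le> norm z \<longrightarrow> g z = 0) \<and>
    (\<integral>\<^sup>+z. ennreal ((U z - g z)\<^sup>2) \<partial>lborel) \<le> ennreal e"
proof -
  obtain M where M: "M \<ge> 0" "(\<integral>\<^sup>+z. ennreal ((U z - max (- M) (min M (U z)))\<^sup>2) \<partial>lborel) < ennreal (e / 4)"
    using L2_approx_bounded[OF U fin, of "e / 4"] assms(4) by auto
  define V where "V z = max (- M) (min M (U z))" for z
  have [measurable]: "V \<in> borel_measurable borel" unfolding V_def by measurable
  obtain g where g: "continuous_on UNIV g" "\<forall>z. R + 1 \<le> norm z \<longrightarrow> g z = 0"
    "(\<integral>\<^sup>+z. ennreal ((V z - g z)\<^sup>2) \<partial>lborel) < ennreal (e / 4)"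
  proof -
    have "\<bar>V z\<bar> \<le> M" for z unfolding V_def using M(1) by linarith
    moreover have "V z = 0" if "R < norm z" for z using R[OF that] M(1) by (simp add: V_def)
    ultimately show ?thesis
      using L2_approx_continuous_bounded[of V M R "e / 4"] assms(4) that by auto
  qed
  have [measurable]: "g \<in> borel_measurable borel" using g(1) by (rule borel_measurable_continuous_onI)
  have "(\<integral>\<^sup>+z. ennreal (((U z - V z) + (V z - g z))\<^sup>2) \<partial>lborel) \<le> ennreal (2 * (e / 4) + 2 * (e / 4))"
    using M(2) g(3) assms(4) by (intro nn_integral_square_add_le) (auto simp: V_def less_imp_le)
  then show ?thesis using g(1,2) by (intro exI[of _ g]) auto
qed

text \<open>A continuous compactly supported \<open>g\<close> near \<open>U\<close> is uniformly
  continuous, and the two errors \<open>U - g\<close>, one of them translated, have equal norm by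
  translation invariance.\<close>

lemma L2_translation_continuous:
  fixes U :: "'a::euclidean_space \<Rightarrow> real"
  assumes U[measurable]: "U \<in> borel_measurable borel" and fin: "(\<integral>\<^sup>+z. ennreal ((U z)\<^sup>2) \<partial>lborel) < \<infinity>"
    and R: "\<And>z. R < norm z \<Longrightarrow> U z = 0" and "0 < e"
  shows "\<exists>d>0. \<forall>h. norm h < d \<longrightarrow> (\<integral>\<^sup>+z. ennreal ((U (z - h) - U z)\<^sup>2) \<partial>lborel) \<le> ennreal e"
proof -
  obtain g where g: "continuous_on UNIV g" "\<forall>z. R + 1 \<le> norm z \<longrightarrow> g z = 0"
    "(\<integral>\<^sup>+z. ennreal ((U z - g z)\<^sup>2) \<partial>lborel) \<le> ennreal (e / 16)"
    using L2_approx_continuous[OF U fin R, where e = "e / 16"] assms(4) by auto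
  have [measurable]: "g \<in> borel_measurable borel" using g(1) by (rule borel_measurable_continuous_onI)
  \<comment> \<open>For \<open>norm h < 1\<close> the difference \<open>g (z - h) - g z\<close> can
    be nonzero only if \<open>norm z < R + 2\<close>; the ball then contains both \<open>z\<close>
    and \<open>z - h\<close>.\<close>
  let ?K = "cball (0::'a) (R + 3)"
  have Kfin: "emeasure lborel ?K < \<infinity>" by (rule emeasure_bounded_finite) simp
  define m where "m = measure lborel ?K"
  have m: "emeasure lborel ?K = ennreal m" "m \<ge> 0"
    using Kfin by (simp_all add: m_def emeasure_eq_ennreal_measure less_top)
  \<comment> \<open>Chosen so that the constant \<open>\<eta>\<^sup>2\<close> integrates over the
    ball to at most \<open>e / 8\<close>; adding 1 to \<open>m\<close> excludes division by
    zero.\<close>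
  define \<eta> where "\<eta> = sqrt (e / (8 * (m + 1)))"
  have \<eta>: "\<eta> > 0" "\<eta>\<^sup>2 * m \<le> e / 8"
  proof -
    show "\<eta> > 0" using m assms(4) by (simp add: \<eta>_def)
    have "\<eta>\<^sup>2 * m = e / 8 * (m / (m + 1))" using m assms(4) by (simp add: \<eta>_def)
    also have "\<dots> \<le> e / 8 * 1" using m assms(4) by (intro mult_left_mono) auto
    finally show "\<eta>\<^sup>2 * m \<le> e / 8" by simp
  qed
  have "uniformly_continuous_on ?K g"
    using g(1) by (intro compact_uniformly_continuous) (auto intro: continuous_on_subset)
  then obtain d where d: "d > 0" "\<And>x y. x \<in> ?K \<Longrightarrow> y \<in> ?K \<Longrightarrow> dist y x < d \<Longrightarrow> dist (g y) (g x) < \<eta>"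
    using \<eta>(1) unfolding uniformly_continuous_on_def by metis
  have "(\<integral>\<^sup>+z. ennreal ((U (z - h) - U z)\<^sup>2) \<partial>lborel) \<le> ennreal e" if h: "norm h < min d 1" for h
  proof -
    have 1: "(\<integral>\<^sup>+z. ennreal ((U (z - h) - g (z - h))\<^sup>2) \<partial>lborel) \<le> ennreal (e / 16)"
      using nn_integral_lborel_translate[of "\<lambda>z. ennreal ((U z - g z)\<^sup>2)" h] g(3) by simp
    have 3: "(\<integral>\<^sup>+z. ennreal ((g z - U z)\<^sup>2) \<partial>lborel) \<le> ennreal (e / 16)"
      using g(3) by (simp add: power2_commute)
    have pt: "(g (z - h) - g z)\<^sup>2 \<le> \<eta>\<^sup>2 * indicator ?K z" for z
    proof (cases "norm z \<le> R + 2")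
      case True
      have "norm (z - h) \<le> R + 3" using True h norm_triangle_ineq4[of z h] by linarith
      then have "z - h \<in> ?K" "z \<in> ?K" using True by (simp_all only: mem_cball_0)
      then have "\<bar>g (z - h) - g z\<bar> < \<eta>"
        using d(2)[of z "z - h"] h by (simp add: dist_norm)
      then show ?thesis using True \<eta>(1) by (simp add: abs_le_square_iff[symmetric])
    next
      case False
      have "norm z \<le> norm (z - h) + norm h" using norm_triangle_ineq[of "z - h" h] by simp
      then have "g (z - h) = 0" "g z = 0" using False h g(2) by auto
      then show ?thesis by simp
    qed
    have "(\<integral>\<^sup>+z. ennreal ((g (z - h) - g z)\<^sup>2) \<partial>lborel) \<le> (\<integral>\<^sup>+z. ennreal (\<eta>\<^sup>2) * indicator ?K z \<partial>lborel)"
    proof (rule nn_integral_mono)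
      fix z
      show "ennreal ((g (z - h) - g z)\<^sup>2) \<le> ennreal (\<eta>\<^sup>2) * indicator ?K z"
        using ennreal_leI[OF pt[of z]] by (cases "z \<in> ?K") auto
    qed
    also have "\<dots> = ennreal (\<eta>\<^sup>2 * m)"
      using m by (simp add: nn_integral_cmult_indicator ennreal_mult)
    also have "\<dots> \<le> ennreal (e / 8)" using \<eta>(2) by (rule ennreal_leI)
    finally have 2: "(\<integral>\<^sup>+z. ennreal ((g (z - h) - g z)\<^sup>2) \<partial>lborel) \<le> ennreal (e / 8)" .
    have 12: "(\<integral>\<^sup>+z. ennreal (((U (z - h) - g (z - h)) + (g (z - h) - g z))\<^sup>2) \<partial>lborel)
        \<le> ennreal (2 * (e / 16) + 2 * (e / 8))"
      using assms(4) by (intro nn_integral_square_add_le 1 2) auto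
    have "(\<integral>\<^sup>+z. ennreal ((((U (z - h) - g (z - h)) + (g (z - h) - g z)) + (g z - U z))\<^sup>2) \<partial>lborel)
        \<le> ennreal (2 * (2 * (e / 16) + 2 * (e / 8)) + 2 * (e / 16))"
      using assms(4) by (intro nn_integral_square_add_le 12 3) auto
    \<comment> \<open>The total is \<open>7 * e / 8\<close>.\<close>
    also have "\<dots> \<le> ennreal e" using assms(4) by (intro ennreal_leI) simp
    finally show ?thesis by simp
  qed
  then show ?thesis using d(1) by (intro exI[of _ "min d 1"]) auto
qed

text \<open>Expands the variance of \<open>f\<close> under the probability density \<open>B\<close>,
  which is nonnegative.\<close>

lemma jensen_square:
  fixes f B :: "'a \<Rightarrow> real"
  assumes "integrable M B" "integral\<^sup>L M B = 1" "integrable M (\<lambda>h. f h * B h)" "integrable M (\<lambda>h. (f h)\<^sup>2 * B h)"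
    and "\<And>h. 0 \<le> B h"
  shows "(\<integral>h. f h * B h \<partial>M)\<^sup>2 \<le> (\<integral>h. (f h)\<^sup>2 * B h \<partial>M)"
proof -
  define m where "m = (\<integral>h. f h * B h \<partial>M)"
  have "0 \<le> (\<integral>h. (f h - m)\<^sup>2 * B h \<partial>M)"
    using assms(5) by (intro Bochner_Integration.integral_nonneg) auto
  also have "(\<lambda>h. (f h - m)\<^sup>2 * B h) = (\<lambda>h. (f h)\<^sup>2 * B h - 2 * m * (f h * B h) + m\<^sup>2 * B h)"
    by (auto simp: fun_eq_iff power2_eq_square algebra_simps)
  also have "(\<integral>h. (f h)\<^sup>2 * B h - 2 * m * (f h * B h) + m\<^sup>2 * B h \<partial>M) = (\<integral>h. (f h)\<^sup>2 * B h \<partial>M) - 2 * m * m + m\<^sup>2 * 1"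
    using assms by (simp add: m_def)
  finally show ?thesis by (simp add: m_def[symmetric] power2_eq_square)
qed

lemma lborel_integral_reflect:
  fixes f :: "'a::euclidean_space \<Rightarrow> real"
  assumes "f \<in> borel_measurable borel"
  shows "(\<integral>h. f (z - h) \<partial>lborel) = integral\<^sup>L lborel f"
    and "integrable lborel f \<Longrightarrow> integrable lborel (\<lambda>h. f (z - h))"
proof -
  have l: "lborel = distr lborel borel (\<lambda>h. z - h)"
    using lborel_affine[of "-1" z] by (simp add: density_1)
  have "integral\<^sup>L lborel f = integral\<^sup>L (distr lborel borel (\<lambda>h. z - h)) f" using l by simp
  also have "\<dots> = (\<integral>h. f (z - h) \<partial>lborel)"
    using assms by (intro integral_distr) auto
  finally show "(\<integral>h. f (z - h) \<partial>lborel) = integral\<^sup>L lborel f" by simp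
  assume "integrable lborel f"
  then have "integrable (distr lborel borel (\<lambda>h. z - h)) f" using l by simp
  then show "integrable lborel (\<lambda>h. f (z - h))"
    by (subst (asm) integrable_distr_eq) (use assms in auto)
qed

text \<open>The mollification error at \<open>z\<close> is an average of
  \<open>U (z - h) - U z\<close> with weight \<open>B h\<close>. Jensen's inequality moves the
  square inside, and after Fubini the inner integral is a translation error with
  \<open>norm h < d\<close>.\<close>

lemma mollify_L2_close:
  fixes U B :: "'a::euclidean_space \<Rightarrow> real"
  assumes U[measurable]: "U \<in> borel_measurable borel" and B[measurable]: "B \<in> borel_measurable borel"
    and intU: "integrable lborel U" "integrable lborel (\<lambda>z. (U z)\<^sup>2)"
    and intB: "integrable lborel B" "integral\<^sup>L lborel B = 1" and B0: "\<And>h. 0 \<le> B h" and BC: "\<And>h. B h \<le> C"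
    and Bd: "\<And>h. d \<le> norm h \<Longrightarrow> B h = 0" and "0 \<le> e"
    and tr: "\<And>h. norm h < d \<Longrightarrow> (\<integral>\<^sup>+z. ennreal ((U (z - h) - U z)\<^sup>2) \<partial>lborel) \<le> ennreal e"
  shows "(\<integral>\<^sup>+z. ennreal (((\<integral>s. U s * B (z - s) \<partial>lborel) - U z)\<^sup>2) \<partial>lborel) \<le> ennreal e"
proof -
  have bd: "integrable lborel (\<lambda>h. f h * B h)" if "integrable lborel f" for f :: "'a \<Rightarrow> real"
  proof (rule Bochner_Integration.integrable_bound[of _ "\<lambda>h. C * f h"])
    have "\<bar>f h * B h\<bar> \<le> \<bar>C * f h\<bar>" for h
      using B0[of h] BC[of h] mult_right_mono[of "B h" C "\<bar>f h\<bar>"] by (simp add: abs_mult mult.commute)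
    then show "AE h in lborel. norm (f h * B h) \<le> norm (C * f h)" by simp
    show "(\<lambda>h. f h * B h) \<in> borel_measurable lborel" using that B by auto
  qed (use that in auto)
  have pt: "ennreal (((\<integral>s. U s * B (z - s) \<partial>lborel) - U z)\<^sup>2) \<le> (\<integral>\<^sup>+h. ennreal ((U (z - h) - U z)\<^sup>2 * B h) \<partial>lborel)" for z
  proof -
    have i1: "integrable lborel (\<lambda>h. U (z - h) * B h)"
      by (intro bd lborel_integral_reflect intU U)
    have i2: "integrable lborel (\<lambda>h. (U (z - h))\<^sup>2 * B h)"
      by (intro bd lborel_integral_reflect(2)[of "\<lambda>z. (U z)\<^sup>2"] intU) auto
    have e1: "(\<lambda>h. (U (z - h) - U z) * B h) = (\<lambda>h. U (z - h) * B h - U z * B h)"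
      by (simp add: fun_eq_iff algebra_simps)
    have e2: "(\<lambda>h. (U (z - h) - U z)\<^sup>2 * B h) = (\<lambda>h. (U (z - h))\<^sup>2 * B h - 2 * U z * (U (z - h) * B h) + (U z)\<^sup>2 * B h)"
      by (simp add: fun_eq_iff power2_eq_square algebra_simps)
    have j1: "integrable lborel (\<lambda>h. (U (z - h) - U z) * B h)"
      unfolding e1 by (intro Bochner_Integration.integrable_diff i1 integrable_mult_right intB)
    have j2: "integrable lborel (\<lambda>h. (U (z - h) - U z)\<^sup>2 * B h)"
      unfolding e2 by (intro Bochner_Integration.integrable_diff Bochner_Integration.integrable_add i1 i2 integrable_mult_right intB)
    have "(\<integral>s. U s * B (z - s) \<partial>lborel) = (\<integral>h. U (z - h) * B h \<partial>lborel)"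
      using lborel_integral_reflect(1)[of "\<lambda>s. U s * B (z - s)" z] by simp
    then have "(\<integral>s. U s * B (z - s) \<partial>lborel) - U z = (\<integral>h. (U (z - h) - U z) * B h \<partial>lborel)"
      unfolding e1 using i1 intB by simp
    then have "((\<integral>s. U s * B (z - s) \<partial>lborel) - U z)\<^sup>2 \<le> (\<integral>h. (U (z - h) - U z)\<^sup>2 * B h \<partial>lborel)"
      using jensen_square[OF intB j1 j2 B0] by simp
    then have "ennreal (((\<integral>s. U s * B (z - s) \<partial>lborel) - U z)\<^sup>2) \<le> ennreal (\<integral>h. (U (z - h) - U z)\<^sup>2 * B h \<partial>lborel)"
      by (rule ennreal_leI)
    also have "\<dots> = (\<integral>\<^sup>+h. ennreal ((U (z - h) - U z)\<^sup>2 * B h) \<partial>lborel)"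
      using j2 B0 by (intro nn_integral_eq_integral[symmetric]) auto
    finally show ?thesis .
  qed
  have "(\<integral>\<^sup>+z. ennreal (((\<integral>s. U s * B (z - s) \<partial>lborel) - U z)\<^sup>2) \<partial>lborel)
      \<le> (\<integral>\<^sup>+z. (\<integral>\<^sup>+h. ennreal ((U (z - h) - U z)\<^sup>2 * B h) \<partial>lborel) \<partial>lborel)"
    by (intro nn_integral_mono pt)
  also have "\<dots> = (\<integral>\<^sup>+h. (\<integral>\<^sup>+z. ennreal ((U (z - h) - U z)\<^sup>2 * B h) \<partial>lborel) \<partial>lborel)"
    by (rule lborel_pair.Fubini') measurable
  also have "\<dots> \<le> (\<integral>\<^sup>+h. ennreal e * ennreal (B h) \<partial>(lborel :: 'a measure))"
  proof (rule nn_integral_mono)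
    fix h :: 'a
    have "(\<integral>\<^sup>+z. ennreal ((U (z - h) - U z)\<^sup>2 * B h) \<partial>lborel)
        = (\<integral>\<^sup>+z. ennreal ((U (z - h) - U z)\<^sup>2) \<partial>lborel) * ennreal (B h)"
      using B0[of h] by (simp add: ennreal_mult nn_integral_multc)
    also have "\<dots> \<le> ennreal e * ennreal (B h)"
      using tr[of h] Bd[of h] by (cases "norm h < d") (auto intro: mult_right_mono)
    finally show "(\<integral>\<^sup>+z. ennreal ((U (z - h) - U z)\<^sup>2 * B h) \<partial>lborel) \<le> ennreal e * ennreal (B h)" .
  qed
  also have "\<dots> = ennreal e * (\<integral>\<^sup>+h. ennreal (B h) \<partial>lborel)"
    by (rule nn_integral_cmult) auto
  also have "(\<integral>\<^sup>+h. ennreal (B h) \<partial>lborel) = ennreal 1"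
    using nn_integral_eq_integral[OF intB(1)] B0 intB(2) by simp
  finally show ?thesis by simp
qed

section \<open>Extension of the mollified solution\<close>

lemma smooth_family_translate:
  assumes "smooth_family f"
  shows "smooth_family (\<lambda>m l (t, x). f m l (t - s, x - y))"
  unfolding smooth_family_def
proof (intro allI conjI)
  fix m l t x
  have "continuous_on UNIV (\<lambda>z. f m l (fst z - s, snd z - y))"
    by (intro continuous_intros continuous_on_compose2[OF smooth_familyD(1)[OF assms, of UNIV]]) auto
  then show "continuous_on UNIV (\<lambda>(t, x). f m l (t - s, x - y))"
    by (simp add: split_def)
  have d: "((\<lambda>t. t - s) has_real_derivative 1) (at t)" "((\<lambda>x. x - y) has_real_derivative 1) (at x)"
    by (auto intro!: derivative_eq_intros)
  show "((\<lambda>t. case (t, x) of (t, x) \<Rightarrow> f m l (t - s, x - y)) has_real_derivative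
      (case (t, x) of (t, x) \<Rightarrow> f (Suc m) l (t - s, x - y))) (at t)"
    using DERIV_chain'[OF d(1) smooth_familyD(2)[OF assms, of m l "x - y"]] by simp
  show "((\<lambda>x. case (t, x) of (t, x) \<Rightarrow> f m l (t - s, x - y)) has_real_derivative
      (case (t, x) of (t, x) \<Rightarrow> f m (Suc l) (t - s, x - y))) (at x)"
    using DERIV_chain'[OF d(2) smooth_familyD(3)[OF assms, of m l "t - s"]] by simp
qed

lemma smooth_family_add: "smooth_family f \<Longrightarrow> smooth_family g \<Longrightarrow> smooth_family (\<lambda>m l z. f m l z + g m l z)"
  unfolding smooth_family_def by (auto intro!: continuous_intros DERIV_add)

lemma smooth_family_cmult: "smooth_family f \<Longrightarrow> smooth_family (\<lambda>m l z. c * f m l z)"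
  unfolding smooth_family_def by (auto intro!: continuous_intros DERIV_cmult)

lemma smooth_family_shift: "smooth_family f \<Longrightarrow> smooth_family (\<lambda>m l. f m (l + k))"
  unfolding smooth_family_def by auto

lemma partial_xI: "(\<And>t x. ((\<lambda>y. f (t, y)) has_real_derivative g (t, x)) (at x)) \<Longrightarrow> partial_x f = g"
  by (auto simp: partial_x_def fun_eq_iff intro!: DERIV_imp_deriv)

lemma partial_tI: "(\<And>t x. ((\<lambda>s. f (s, x)) has_real_derivative g (t, x)) (at t)) \<Longrightarrow> partial_t f = g"
  by (auto simp: partial_t_def fun_eq_iff intro!: DERIV_imp_deriv)

text \<open>Leibniz rule, grouped for \<open>p\<close> a cutoff and \<open>q\<close> a reflected
  fundamental solution: the term with undifferentiated \<open>p\<close> carries the source, and all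
  others contain a derivative of \<open>p\<close>.\<close>

lemma kdvb_dual_mult:
  assumes p: "smooth_family p" and q: "smooth_family q"
  shows "kdvb_dual (\<lambda>z. p 0 0 z * q 0 0 z) z = q 0 0 z * (p 1 0 z + p 0 2 z + p 0 3 z) + p 0 0 z * (q 1 0 z + q 0 2 z + q 0 3 z)
    + q 0 1 z * (2 * p 0 1 z + 3 * p 0 2 z) + 3 * q 0 2 z * p 0 1 z"
proof -
  note d = smooth_familyD(3)[OF p] smooth_familyD(3)[OF q]
  have t: "partial_t (\<lambda>z. p 0 0 z * q 0 0 z) = (\<lambda>z. p 1 0 z * q 0 0 z + p 0 0 z * q 1 0 z)"
    using DERIV_mult[OF smooth_familyD(2)[OF p] smooth_familyD(2)[OF q]]
    by (intro partial_tI) (simp add: algebra_simps)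
  have x1: "partial_x (\<lambda>z. p 0 0 z * q 0 0 z) = (\<lambda>z. p 0 1 z * q 0 0 z + p 0 0 z * q 0 1 z)"
    by (rule partial_xI, (rule derivative_eq_intros d refl)+) (simp add: algebra_simps)
  have x2: "partial_x (\<lambda>z. p 0 1 z * q 0 0 z + p 0 0 z * q 0 1 z)
      = (\<lambda>z. p 0 2 z * q 0 0 z + 2 * (p 0 1 z * q 0 1 z) + p 0 0 z * q 0 2 z)"
    by (rule partial_xI, (rule derivative_eq_intros d refl)+) (simp add: algebra_simps numeral_2_eq_2)
  have x3: "partial_x (\<lambda>z. p 0 2 z * q 0 0 z + 2 * (p 0 1 z * q 0 1 z) + p 0 0 z * q 0 2 z)
      = (\<lambda>z. p 0 3 z * q 0 0 z + 3 * (p 0 2 z * q 0 1 z) + 3 * (p 0 1 z * q 0 2 z) + p 0 0 z * q 0 3 z)"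
    by (rule partial_xI, (rule derivative_eq_intros d refl)+) (simp add: algebra_simps numeral_2_eq_2 numeral_3_eq_3)
  show ?thesis
    unfolding kdvb_dual_def t x1 x2 x3 by (simp add: algebra_simps)
qed

lemma integrable_tensor:
  fixes f :: "'a::euclidean_space \<Rightarrow> real" and g :: "'b::euclidean_space \<Rightarrow> real"
  assumes "integrable lborel f" "integrable lborel g"
  shows "integrable (lborel \<Otimes>\<^sub>M lborel) (\<lambda>(x, y). f x * g y)"
proof (rule lborel_pair.Fubini_integrable)
  have [measurable]: "f \<in> borel_measurable borel" "g \<in> borel_measurable borel"
    using assms by auto
  show "(\<lambda>(x, y). f x * g y) \<in> borel_measurable (lborel \<Otimes>\<^sub>M lborel)"
    by measurable
  show "integrable lborel (\<lambda>x. \<integral>y. norm (case (x, y) of (x, y) \<Rightarrow> f x * g y) \<partial>lborel)"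
    using assms by (simp add: abs_mult)
qed (use assms in auto)

text \<open>\<open>U\<close> is the given solution extended by zero, and \<open>\<zeta> k\<close> is the \<open>k\<close>-th derivative of the cutoff.\<close>

locale kdvb_extension = gevrey_mollifier b C d for b :: "nat \<Rightarrow> real \<Rightarrow> real" and C d :: real +
  fixes N T t1 t2 :: real and \<zeta> :: "nat \<Rightarrow> real \<Rightarrow> real" and U :: "real \<times> real \<Rightarrow> real"
  assumes d_le: "d \<le> 1 / 4" and N_ge: "1 \<le> N"
    and \<zeta>_deriv: "(\<zeta> k has_real_derivative \<zeta> (Suc k) y) (at y)"
    and \<zeta>_left: "y \<le> - N + 1 / 4 \<Longrightarrow> \<zeta> k y = 0"
    and \<zeta>_right: "- N + 3 / 4 \<le> y \<Longrightarrow> \<zeta> 0 y = 1"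
    and \<zeta>_right': "- N + 3 / 4 \<le> y \<Longrightarrow> \<zeta> (Suc k) y = 0"
    and U_int: "integrable lborel U"
    and U_outside: "z \<notin> {0<..<T} \<times> {-N<..<N} \<Longrightarrow> U z = 0"
    and U_support: "AE z in lborel. U z \<noteq> 0 \<longrightarrow> t1 \<le> fst z \<and> fst z \<le> t2"
    and U_weak: "\<phi> \<in> test_functions ({0<..<T} \<times> {-N<..<N}) \<Longrightarrow> (\<integral>z. U z * kdvb_dual \<phi> z \<partial>lborel) = 0"
    and t1_d: "2 * d < t1" and t2_d: "t2 + 2 * d < T"
begin

text \<open>Large enough that \<open>x - y\<close> stays within \<open>Z - 1\<close> whenever
  \<open>\<bar>x\<bar> < N + 1\<close> and \<open>\<bar>y\<bar> < N\<close>; there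
  \<open>flux\<close> vanishes at the ends \<open>Z\<close> and \<open>-Z\<close>.\<close>

definition Z :: real where "Z = 2 * N + 4"

text \<open>For \<open>\<bar>q\<bar> \<le> Z - 1\<close> this solves the homogeneous equation,
  whereas \<open>causal\<close> has the source \<open>b 0 r * b 0 q\<close> and vanishes for
  \<open>q \<le> -d\<close>. The two agree for \<open>q \<ge> d\<close>.\<close>

definition entire :: "nat \<Rightarrow> nat \<Rightarrow> real \<times> real \<Rightarrow> real" where "entire = conv (- Z) Z"

definition causal :: "nat \<Rightarrow> nat \<Rightarrow> real \<times> real \<Rightarrow> real" where "causal = conv 0 Z"

lemma Z_ge: "0 \<le> Z" using N_ge by (simp add: Z_def)

lemma entire_smooth: "smooth_family entire" and causal_smooth: "smooth_family causal"
  by (simp_all add: entire_def causal_def conv_smooth_family)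

lemma entire_equation:
  assumes "\<bar>q\<bar> \<le> Z - 1"
  shows "entire 1 l (r, q) - entire 0 (l + 2) (r, q) + entire 0 (l + 3) (r, q) = 0"
  unfolding entire_def using conv_equation[of "- Z" Z l r q] Z_ge assms d_le
  by (simp add: flux_eq_0)

lemma causal_equation:
  assumes "\<bar>q\<bar> \<le> Z - 1"
  shows "causal 1 0 (r, q) - causal 0 2 (r, q) + causal 0 3 (r, q) = b 0 r * b 0 q"
  using conv_equation[of 0 Z 0 r q] Z_ge assms d_le
  by (simp add: causal_def flux_eq_0 flux_at_0 numeral_2_eq_2 mult.commute)

lemma \<zeta>_continuous: "continuous_on A (\<zeta> k)"
  using DERIV_isCont[OF \<zeta>_deriv] by (simp add: continuous_at_imp_continuous_on)

text \<open>The terms of the dual operator applied to \<open>(s, y) \<mapsto> \<zeta>(y) F(t - s, x - y)\<close> that contain a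
  derivative of \<open>\<zeta>\<close>, with the sign changed.\<close>

definition kernel :: "(nat \<Rightarrow> nat \<Rightarrow> real \<times> real \<Rightarrow> real) \<Rightarrow> real \<times> real \<Rightarrow> real \<times> real \<Rightarrow> real" where
  "kernel F = (\<lambda>(t, x) (s, y). - (\<zeta> 2 y + \<zeta> 3 y) * F 0 0 (t - s, x - y)
     + (2 * \<zeta> 1 y + 3 * \<zeta> 2 y) * F 0 1 (t - s, x - y) - 3 * \<zeta> 1 y * F 0 2 (t - s, x - y))"

text \<open>Use of \<open>entire\<close> in place of \<open>causal\<close> lets the kernel solve the
  homogeneous equation in its first argument on the whole wider strip, whatever the position of the
  source.\<close>

definition H :: "real \<times> real \<Rightarrow> real \<times> real \<Rightarrow> real" where "H = kernel entire"

definition v :: "real \<times> real \<Rightarrow> real" where "v w = - (\<integral>z. U z * H w z \<partial>lborel)"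

section \<open>The extension: bounds, support in time and equation\<close>

lemma H_continuous: "continuous_on A (\<lambda>(w, z). H w z)"
proof -
  have "continuous_on A (\<lambda>p. entire m l (fst (fst p) - fst (snd p), snd (fst p) - snd (snd p)))" for m l
    by (intro continuous_intros continuous_on_compose2[OF smooth_familyD(1)[OF entire_smooth, of UNIV]]) auto
  moreover have "continuous_on A (\<lambda>p. \<zeta> k (snd (snd p)))" for k
    by (intro continuous_intros continuous_on_compose2[OF \<zeta>_continuous[of UNIV]]) auto
  ultimately show ?thesis
    unfolding H_def kernel_def split_def by (intro continuous_intros)
qed

lemma H_measurable [measurable]: "(\<lambda>(w, z). H w z) \<in> borel_measurable (lborel \<Otimes>\<^sub>M lborel)"
  using borel_measurable_continuous_onI[OF H_continuous] by (simp add: lborel_prod)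

lemma H_measurable' [measurable]: "H w \<in> borel_measurable borel"
proof -
  have "continuous_on UNIV (\<lambda>z. (\<lambda>(w, z). H w z) (w, z))"
    by (intro continuous_on_compose2[OF H_continuous[of UNIV]] continuous_intros) auto
  then show ?thesis by (intro borel_measurable_continuous_onI) simp
qed

lemma H_bounded:
  assumes "compact K"
  shows "\<exists>M\<ge>0. \<forall>w\<in>K. \<forall>z\<in>{0<..<T} \<times> {-N<..<N}. \<bar>H w z\<bar> \<le> M"
proof -
  have "compact (K \<times> ({0..T} \<times> {-N..N}))"
    using assms by (intro compact_Times) auto
  then have "bounded ((\<lambda>(w, z). H w z) ` (K \<times> ({0..T} \<times> {-N..N})))"
    by (intro compact_imp_bounded compact_continuous_image H_continuous)
  then obtain M where M: "\<And>w z. w \<in> K \<Longrightarrow> z \<in> {0..T} \<times> {-N..N} \<Longrightarrow> \<bar>H w z\<bar> \<le> M"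
    by (fastforce simp: bounded_iff)
  have "\<bar>H w z\<bar> \<le> max 0 M" if "w \<in> K" "z \<in> {0<..<T} \<times> {-N<..<N}" for w z
  proof -
    have "z \<in> {0..T} \<times> {-N..N}" using that(2) by auto
    then show ?thesis using M[OF that(1)] by fastforce
  qed
  then show ?thesis by (intro exI[of _ "max 0 M"]) auto
qed

lemma U_mult_integrable:
  assumes [measurable]: "g \<in> borel_measurable borel" and M: "\<And>z. z \<in> {0<..<T} \<times> {-N<..<N} \<Longrightarrow> \<bar>g z\<bar> \<le> M"
  shows "integrable lborel (\<lambda>z. U z * g z)"
proof (rule Bochner_Integration.integrable_bound[of _ "\<lambda>z. M * U z"])
  have "\<bar>U z * g z\<bar> \<le> \<bar>M * U z\<bar>" for z
  proof (cases "z \<in> {0<..<T} \<times> {-N<..<N}")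
    case True
    then have "\<bar>g z\<bar> \<le> \<bar>M\<bar>" using M[of z] by linarith
    then show ?thesis using mult_right_mono[of "\<bar>g z\<bar>" "\<bar>M\<bar>" "\<bar>U z\<bar>"] by (simp add: abs_mult mult.commute)
  qed (simp add: U_outside)
  then show "AE z in lborel. norm (U z * g z) \<le> norm (M * U z)" by simp
  show "(\<lambda>z. U z * g z) \<in> borel_measurable lborel" using U_int by measurable
qed (use U_int in auto)

lemma UH_integrable: "integrable lborel (\<lambda>z. U z * H w z)"
proof -
  obtain M where "\<forall>z\<in>{0<..<T} \<times> {-N<..<N}. \<bar>H w z\<bar> \<le> M"
    using H_bounded[OF finite_imp_compact[of "{w}"], simplified] by blast
  then show ?thesis by (intro U_mult_integrable[where M = M]) auto
qed

lemma v_measurable [measurable]: "v \<in> borel_measurable borel"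
proof -
  have [measurable]: "U \<in> borel_measurable borel" using U_int by auto
  have "(\<lambda>w. \<integral>z. U z * H w z \<partial>lborel) \<in> borel_measurable lborel"
    by (rule lborel.borel_measurable_lebesgue_integral) measurable
  then show ?thesis unfolding v_def[abs_def] by simp
qed

lemma v_bounded:
  assumes "compact K"
  obtains M where "\<And>w. w \<in> K \<Longrightarrow> \<bar>v w\<bar> \<le> M"
proof -
  obtain M where M: "0 \<le> M" "\<And>w z. w \<in> K \<Longrightarrow> z \<in> {0<..<T} \<times> {-N<..<N} \<Longrightarrow> \<bar>H w z\<bar> \<le> M"
    using H_bounded[OF assms] by blast
  show ?thesis
  proof (rule that)
    fix w assume w: "w \<in> K"
    have "\<bar>U z * H w z\<bar> \<le> M * \<bar>U z\<bar>" for z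
      using M(2)[OF w, of z] U_outside[of z]
      by (cases "z \<in> {0<..<T} \<times> {-N<..<N}") (auto simp: abs_mult mult.commute[of M] intro!: mult_left_mono)
    then have "(\<integral>z. \<bar>U z * H w z\<bar> \<partial>lborel) \<le> (\<integral>z. M * \<bar>U z\<bar> \<partial>lborel)"
      using UH_integrable U_int by (intro integral_mono) auto
    then show "\<bar>v w\<bar> \<le> (\<integral>z. M * \<bar>U z\<bar> \<partial>lborel)"
      using integral_abs_bound[of lborel "\<lambda>z. U z * H w z"] unfolding v_def by linarith
  qed
qed

lemma v_L2: "bounded \<Omega> \<Longrightarrow> \<Omega> \<in> sets borel \<Longrightarrow> v \<in> L2_space \<Omega>"
proof -
  assume \<Omega>: "bounded \<Omega>" "\<Omega> \<in> sets borel"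
  then have "compact (closure \<Omega>)" by (simp add: compact_closure)
  then obtain M where M: "\<And>w. w \<in> closure \<Omega> \<Longrightarrow> \<bar>v w\<bar> \<le> M" using v_bounded by blast
  have "integrable lborel (indicator \<Omega> :: real \<times> real \<Rightarrow> real)"
    using \<Omega> emeasure_bounded_finite[OF \<Omega>(1)] by (intro integrable_real_indicator) auto
  then have "integrable lborel (\<lambda>z. M\<^sup>2 * indicator \<Omega> z)" by simp
  then have "integrable lborel (\<lambda>z. indicator \<Omega> z *\<^sub>R (v z)\<^sup>2)"
  proof (rule Bochner_Integration.integrable_bound)
    show "AE z in lborel. norm (indicator \<Omega> z *\<^sub>R (v z)\<^sup>2) \<le> norm (M\<^sup>2 * indicator \<Omega> z)"
    proof (intro always_eventually allI)
      fix z
      show "norm (indicator \<Omega> z *\<^sub>R (v z)\<^sup>2) \<le> norm (M\<^sup>2 * indicator \<Omega> z)"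
      proof (cases "z \<in> \<Omega>")
        case True
        then have "\<bar>v z\<bar> \<le> \<bar>M\<bar>" using M[of z] closure_subset[of \<Omega>] by fastforce
        then show ?thesis using True by (simp add: abs_le_square_iff)
      qed simp
    qed
  qed (use \<Omega> in measurable)
  moreover have "(\<lambda>z. indicator \<Omega> z *\<^sub>R v z) \<in> borel_measurable lborel"
    using \<Omega>(2) by measurable
  ultimately show ?thesis by (simp add: L2_space_def set_borel_measurable_def set_integrable_def)
qed

lemma AE_U_far:
  assumes "t < t1 - d \<or> t2 + d < t"
  shows "AE z in lborel. U z \<noteq> 0 \<longrightarrow> d \<le> \<bar>t - fst z\<bar>"
  using U_support by eventually_elim (use assms in auto)

lemma v_support:
  assumes "t < t1 - d \<or> t2 + d < t"
  shows "v (t, x) = 0"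
proof -
  have "AE z in lborel. U z * H (t, x) z = 0"
    using AE_U_far[OF assms]
    by eventually_elim (auto simp: H_def kernel_def entire_def conv_support_t split: prod.split)
  then have "(\<integral>z. U z * H (t, x) z \<partial>lborel) = 0" by (rule integral_eq_zero_AE)
  then show ?thesis by (simp add: v_def)
qed

text \<open>For fixed \<open>z\<close> the kernel is a linear combination, with coefficients
  depending on \<open>y\<close> only, of translates of \<open>entire\<close> and its first two
  \<open>x\<close>-derivatives. Each of these is a classical solution in the range that
  occurs.\<close>

lemma H_solves:
  assumes "z \<in> {0<..<T} \<times> {-N<..<N}" and \<phi>: "\<phi> \<in> test_functions ({0<..<T} \<times> {-N-1<..<N+1})"
  shows "(\<integral>w. H w z * kdvb_dual \<phi> w \<partial>lborel) = 0"
proof -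
  obtain s y where z: "z = (s, y)" by (cases z)
  let ?tr = "\<lambda>k m l (t, x). entire m (l + k) (t - s, x - y)"
  define E where "E = (\<lambda>m l w. (- (\<zeta> 2 y + \<zeta> 3 y) * ?tr 0 m l w
     + (2 * \<zeta> 1 y + 3 * \<zeta> 2 y) * ?tr 1 m l w) + (- 3 * \<zeta> 1 y) * ?tr 2 m l w)"
  have E: "smooth_family E"
    unfolding E_def
    by (intro smooth_family_add smooth_family_cmult
        smooth_family_translate[OF smooth_family_shift[OF entire_smooth]])
  have "E 1 0 w - E 0 2 w + E 0 3 w = 0" if w: "w \<in> {0<..<T} \<times> {-N-1<..<N+1}" for w
  proof -
    obtain t x where tx: "w = (t, x)" by (cases w)
    have q: "\<bar>x - y\<bar> \<le> Z - 1" using w assms(1) by (auto simp: tx z Z_def)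
    have eq: "entire 1 l (t - s, x - y) = entire 0 (l + 2) (t - s, x - y) - entire 0 (l + 3) (t - s, x - y)" for l
      using entire_equation[OF q, of l "t - s"] by simp
    show ?thesis
      unfolding E_def tx prod.case eq by (simp add: algebra_simps eval_nat_numeral)
  qed
  then have "(\<integral>w. E 0 0 w * kdvb_dual \<phi> w \<partial>lborel) = 0"
    using classical_imp_weak[OF E \<phi>] by blast
  moreover have "E 0 0 w = H w z" for w
    by (cases w) (simp add: E_def H_def kernel_def z numeral_2_eq_2)
  ultimately show ?thesis by simp
qed

text \<open>Fubini carries the dual operator onto \<open>H\<close>, where \<open>H_solves\<close>
  applies for each \<open>z\<close>. Domination comes from the bound of \<open>H\<close> on the
  compact support of the test function times a tensor product of integrable functions.\<close>

lemma v_solves: "solves_KdVB ({0<..<T} \<times> {-N-1<..<N+1}) v"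
proof -
  let ?\<Omega> = "{0<..<T} \<times> {-N-1<..<N+1}"
  have \<Omega>: "bounded ?\<Omega>" "?\<Omega> \<in> sets borel"
    by (auto intro!: bounded_Times borel_open open_Times)
  have "set_lebesgue_integral lborel ?\<Omega> (\<lambda>w. v w * kdvb_dual \<phi> w) = 0" if \<phi>: "\<phi> \<in> test_functions ?\<Omega>" for \<phi>
  proof -
    obtain K where K: "compact K" "K \<subseteq> ?\<Omega>" "\<forall>z. z \<notin> K \<longrightarrow> \<phi> z = 0 \<and> partial_t \<phi> z = 0 \<and> partial_x \<phi> z = 0 \<and>
      partial_x (partial_x \<phi>) z = 0 \<and> partial_x (partial_x (partial_x \<phi>)) z = 0"
      using test_function_support[OF \<phi>] by blast
    then have a0: "kdvb_dual \<phi> w = 0" if "w \<notin> K" for w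
      using that by (simp add: kdvb_dual_def del: split_paired_All)
    have ac: "continuous_on UNIV (kdvb_dual \<phi>)"
      unfolding kdvb_dual_def by (intro continuous_intros test_function_continuous[OF \<phi>])
    then have [measurable]: "kdvb_dual \<phi> \<in> borel_measurable borel" by (rule borel_measurable_continuous_onI)
    have aint: "integrable lborel (kdvb_dual \<phi>)" by (rule integrable_continuous_support[OF ac K(1) a0])
    have [measurable]: "U \<in> borel_measurable borel" using U_int by auto
    obtain M where M: "0 \<le> M" "\<And>w z. w \<in> K \<Longrightarrow> z \<in> {0<..<T} \<times> {-N<..<N} \<Longrightarrow> \<bar>H w z\<bar> \<le> M"
      using H_bounded[OF K(1)] by blast
    let ?f = "\<lambda>w z. U z * H w z * kdvb_dual \<phi> w"
    have int: "integrable (lborel \<Otimes>\<^sub>M lborel) (\<lambda>(w, z). ?f w z)"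
    proof (rule Bochner_Integration.integrable_bound)
      show "integrable (lborel \<Otimes>\<^sub>M lborel) (\<lambda>(w, z). (M * kdvb_dual \<phi> w) * U z)"
        by (intro integrable_tensor integrable_mult_right aint U_int)
      show "(\<lambda>(w, z). ?f w z) \<in> borel_measurable (lborel \<Otimes>\<^sub>M lborel)" by measurable
      have "\<bar>?f w z\<bar> \<le> \<bar>M * kdvb_dual \<phi> w * U z\<bar>" for w z
      proof (cases "w \<in> K \<and> z \<in> {0<..<T} \<times> {-N<..<N}")
        case True
        then have "\<bar>H w z\<bar> * (\<bar>kdvb_dual \<phi> w\<bar> * \<bar>U z\<bar>) \<le> M * (\<bar>kdvb_dual \<phi> w\<bar> * \<bar>U z\<bar>)"
          by (intro mult_right_mono M) auto
        then show ?thesis using M(1) by (simp add: abs_mult algebra_simps)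
      next
        case False
        then show ?thesis using a0[of w] U_outside[of z] by auto
      qed
      then show "AE p in lborel \<Otimes>\<^sub>M lborel. norm (case p of (w, z) \<Rightarrow> ?f w z) \<le> norm (case p of (w, z) \<Rightarrow> M * kdvb_dual \<phi> w * U z)"
        by (simp add: split_def)
    qed
    have "set_lebesgue_integral lborel ?\<Omega> (\<lambda>w. v w * kdvb_dual \<phi> w) = (\<integral>w. v w * kdvb_dual \<phi> w \<partial>lborel)"
      unfolding set_lebesgue_integral_def
      by (rule Bochner_Integration.integral_cong) (use a0 K(2) in \<open>auto simp: indicator_def\<close>)
    also have "\<dots> = (\<integral>w. - (\<integral>z. ?f w z \<partial>lborel) \<partial>lborel)"
      using UH_integrable by (intro Bochner_Integration.integral_cong refl) (simp add: v_def)
    also have "\<dots> = - (\<integral>w. (\<integral>z. ?f w z \<partial>lborel) \<partial>lborel)" by simp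
    also have "(\<integral>w. (\<integral>z. ?f w z \<partial>lborel) \<partial>lborel) = (\<integral>z. (\<integral>w. ?f w z \<partial>lborel) \<partial>lborel)"
      by (rule lborel_pair.Fubini_integral[OF int, symmetric])
    also have "\<dots> = 0"
    proof -
      have "(\<integral>w. ?f w z \<partial>lborel) = 0" for z
      proof (cases "z \<in> {0<..<T} \<times> {-N<..<N}")
        case True
        have "(\<integral>w. ?f w z \<partial>lborel) = (\<integral>w. U z * (H w z * kdvb_dual \<phi> w) \<partial>lborel)"
          by (simp add: mult.assoc)
        also have "\<dots> = U z * (\<integral>w. H w z * kdvb_dual \<phi> w \<partial>lborel)" by simp
        finally show ?thesis using H_solves[OF True \<phi>] by simp
      qed (simp add: U_outside)
      then show ?thesis by simp
    qed
    finally show ?thesis by simp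
  qed
  then show ?thesis
    using solves_KdVB_iff[OF L2_imp_set_integrable[OF v_L2[OF \<Omega>] \<Omega>(2,1)]] by blast
qed

text \<open>The equation for \<open>U\<close> enters here, tested against the cutoff times the
  reflected \<open>causal\<close>. The source yields the mollified \<open>U\<close> and the
  derivatives of the cutoff yield \<open>H\<close>.\<close>

lemma v_eq_mollified:
  assumes x: "- N + 1 < x" "x < N - 1"
  shows "v (t, x) = (\<integral>z. U z * (b 0 (t - fst z) * b 0 (x - snd z)) \<partial>lborel)"
\<comment> \<open>For \<open>t\<close> away from the support of \<open>U\<close> both sides vanish.
  The remaining \<open>t\<close> keep \<open>{t - d..t + d}\<close> inside \<open>(0, T)\<close>, so
  that the test function is admissible.\<close>
proof (cases "t < t1 - d \<or> t2 + d < t")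
  case True
  have "AE z in lborel. U z * (b 0 (t - fst z) * b 0 (x - snd z)) = 0"
    using AE_U_far[OF True] by eventually_elim (auto simp: b_support)
  then have "(\<integral>z. U z * (b 0 (t - fst z) * b 0 (x - snd z)) \<partial>lborel) = 0" by (rule integral_eq_zero_AE)
  then show ?thesis using v_support[OF True] by simp
next
  case False
  define p :: "nat \<Rightarrow> nat \<Rightarrow> real \<times> real \<Rightarrow> real" where "p = (\<lambda>m l (t, x). if m = 0 then \<zeta> l x else 0)"
  define q where "q = (\<lambda>m l (s, y). (-1) ^ (m + l) * causal m l (t - s, x - y))"
  have p: "smooth_family p" unfolding p_def by (rule smooth_family_of_x[where X = \<zeta>, OF \<zeta>_deriv])
  have q: "smooth_family q" unfolding q_def by (rule smooth_family_reflect[OF causal_smooth])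
  define \<phi> where "\<phi> = (\<lambda>z. p 0 0 z * q 0 0 z)"
  have "\<phi> \<in> test_functions ({0<..<T} \<times> {-N<..<N})"
  proof (rule test_functionsI[where K = "{t - d..t + d} \<times> {- N + 1 / 4..x + d}"])
    show "C_k k \<phi>" for k
      unfolding \<phi>_def by (intro C_k_mult smooth_family_C_k p q)
    show "compact ({t - d..t + d} \<times> {- N + 1 / 4..x + d})" by (intro compact_Times) auto
    show "{t - d..t + d} \<times> {- N + 1 / 4..x + d} \<subseteq> {0<..<T} \<times> {-N<..<N}"
      using False x t1_d t2_d d_le by auto
    fix z assume "z \<notin> {t - d..t + d} \<times> {- N + 1 / 4..x + d}"
    \<comment> \<open>The three ways to leave the compact set: the cutoff vanishes on the left,
      \<open>causal\<close> vanishes left of its source (large \<open>y\<close>), and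
      \<open>b\<close> has bounded support in time.\<close>
    then consider "snd z < - N + 1 / 4" | "x - snd z \<le> - d" | "d \<le> \<bar>t - fst z\<bar>"
      by (cases z) fastforce
    then show "\<phi> z = 0"
      by cases (auto simp: \<phi>_def p_def q_def causal_def \<zeta>_left conv_causal conv_support_t split: prod.split)
  qed
  then have zero: "(\<integral>z. U z * kdvb_dual \<phi> z \<partial>lborel) = 0" by (rule U_weak)
  have pt: "U z * kdvb_dual \<phi> z = - (U z * (b 0 (t - fst z) * b 0 (x - snd z))) - U z * H (t, x) z" for z
  proof (cases "z \<in> {0<..<T} \<times> {-N<..<N}")
    case True
    obtain s y where z: "z = (s, y)" by (cases z)
    have Q: "\<bar>x - y\<bar> \<le> Z - 1" using True x by (auto simp: z Z_def)
    \<comment> \<open>Where a derivative of the cutoff may be nonzero,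
      \<open>y < - N + 3 / 4\<close>, hence \<open>x - y > 1 / 4 \<ge> d\<close>, and the point is
      to the right of the source.\<close>
    have ker: "kernel causal (t, x) z = H (t, x) z"
    proof (cases "y < - N + 3 / 4")
      case True
      then have "causal 0 l (t - s, x - y) = entire 0 l (t - s, x - y)" for l
        using x d_le Z_ge by (simp add: causal_def entire_def conv_eq_entire)
      then show ?thesis by (simp add: H_def kernel_def z)
    next
      case False
      then have "\<zeta> 1 y = 0" "\<zeta> 2 y = 0" "\<zeta> 3 y = 0"
        using \<zeta>_right'[of y] by (simp_all add: numeral_2_eq_2 numeral_3_eq_3)
      then show ?thesis by (simp add: H_def kernel_def z)
    qed
    \<comment> \<open>On the support of \<open>b 0 (x - y)\<close> one has
      \<open>y > x - d > - N + 3 / 4\<close>, where the cutoff is 1.\<close>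
    have cut: "\<zeta> 0 y * b 0 (x - y) = b 0 (x - y)"
      using x d_le \<zeta>_right[of y] b_support[of "x - y" 0] by (cases "- N + 3 / 4 \<le> y") auto
    \<comment> \<open>Reflection changes the sign of the derivatives of odd order and so turns the
      dual operator into minus the original one.\<close>
    have "q 1 0 z + q 0 2 z + q 0 3 z = - (b 0 (t - s) * b 0 (x - y))"
      using causal_equation[OF Q, of "t - s"] by (simp add: q_def z)
    then have "kdvb_dual \<phi> z = causal 0 0 (t - s, x - y) * (\<zeta> 2 y + \<zeta> 3 y) - \<zeta> 0 y * (b 0 (t - s) * b 0 (x - y))
        - causal 0 1 (t - s, x - y) * (2 * \<zeta> 1 y + 3 * \<zeta> 2 y) + 3 * causal 0 2 (t - s, x - y) * \<zeta> 1 y"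
      unfolding \<phi>_def kdvb_dual_mult[OF p q] by (simp add: p_def q_def z)
    also have "\<dots> = - (\<zeta> 0 y * b 0 (x - y)) * b 0 (t - s) - kernel causal (t, x) z"
      by (simp add: kernel_def z algebra_simps)
    finally have adj: "kdvb_dual \<phi> z = - b 0 (x - y) * b 0 (t - s) - H (t, x) z"
      unfolding ker cut .
    show ?thesis
      unfolding adj by (simp add: z algebra_simps)
  qed (simp add: U_outside)
  have int: "integrable lborel (\<lambda>z. U z * (b 0 (t - fst z) * b 0 (x - snd z)))"
  proof (rule U_mult_integrable)
    have "continuous_on UNIV (\<lambda>z::real\<times>real. b 0 (t - fst z) * b 0 (x - snd z))"
      by (intro continuous_intros continuous_on_compose2[OF b_continuous[of UNIV]]) auto
    then show "(\<lambda>z. b 0 (t - fst z) * b 0 (x - snd z)) \<in> borel_measurable borel"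
      by (rule borel_measurable_continuous_onI)
    show "\<bar>b 0 (t - fst z) * b 0 (x - snd z)\<bar> \<le> C * C" for z
      unfolding abs_mult using b_bound[of 0] C_nonneg by (intro mult_mono) auto
  qed
  have "(\<integral>z. U z * kdvb_dual \<phi> z \<partial>lborel)
      = - (\<integral>z. U z * (b 0 (t - fst z) * b 0 (x - snd z)) \<partial>lborel) - (\<integral>z. U z * H (t, x) z \<partial>lborel)"
    unfolding pt using int UH_integrable[of "(t, x)"] by simp
  then show ?thesis using zero by (simp add: v_def)
qed

end

section \<open>Choice of parameters and conclusion\<close>

theorem theorem5p4:
  fixes n :: nat and t1 t2 T :: real and u :: "real \<times> real \<Rightarrow> real"
  assumes "n \<notin> {0, 1}"
    and "0 < t1" and "t1 < t2" and "t2 < T"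
    and "u \<in> L2_space ({0<..<T} \<times> {- real n<..<real n})"
    and "solves_KdVB ({0<..<T} \<times> {- real n<..<real n}) u"
    and "ess_support ({0<..<T} \<times> {- real n<..<real n}) u \<subseteq> {t1..t2} \<times> {- real n<..<real n}"
  shows "\<forall>\<epsilon>. 0 < \<epsilon> \<and> \<epsilon> < min t1 (T - t2) \<longrightarrow>
    (\<exists>v \<in> L2_space ({0<..<T} \<times> {- real n - 1<..<real n + 1}).
      solves_KdVB ({0<..<T} \<times> {- real n - 1<..<real n + 1}) v \<and>
      ess_support ({0<..<T} \<times> {- real n - 1<..<real n + 1}) v
        \<subseteq> {t1 - \<epsilon>..t2 + \<epsilon>} \<times> {- real n - 1<..<real n + 1} \<and>
      L2_norm ({0<..<T} \<times> {- real n + 1<..<real n - 1}) (\<lambda>z. v z - u z) < \<epsilon>)"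
proof (intro allI impI)
  fix \<epsilon> :: real
  assume \<epsilon>: "0 < \<epsilon> \<and> \<epsilon> < min t1 (T - t2)"
  define N where "N = real n"
  have N: "1 \<le> N" using assms(1) by (cases n) (auto simp: N_def)
  let ?\<Omega> = "{0<..<T} \<times> {-N<..<N}"
  have \<Omega>: "open ?\<Omega>" "?\<Omega> \<in> sets borel" "bounded ?\<Omega>"
    by (auto intro!: bounded_Times borel_open open_Times)
  define U where "U z = indicator ?\<Omega> z * u z" for z
  have U_meas [measurable]: "U \<in> borel_measurable borel"
    using assms(5) by (simp add: L2_space_def set_borel_measurable_def U_def[abs_def] N_def)
  have U_int: "integrable lborel U"
    using L2_imp_set_integrable[OF assms(5)] \<Omega> by (simp add: set_integrable_def U_def[abs_def] N_def)
  have "(\<lambda>z. (U z)\<^sup>2) = (\<lambda>z. indicator ?\<Omega> z *\<^sub>R (u z)\<^sup>2)"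
    by (auto simp: U_def fun_eq_iff indicator_def)
  then have U2_int: "integrable lborel (\<lambda>z. (U z)\<^sup>2)"
    using assms(5) by (simp add: L2_space_def set_integrable_def N_def)
  then have U2_fin: "(\<integral>\<^sup>+z. ennreal ((U z)\<^sup>2) \<partial>lborel) < \<infinity>"
    using nn_integral_eq_integral[OF U2_int] by simp
  obtain R where R: "\<And>z. z \<in> ?\<Omega> \<Longrightarrow> norm z \<le> R"
    using \<Omega>(3) by (auto simp: bounded_iff)
  have U_out: "R < norm z \<Longrightarrow> U z = 0" for z
    using R[of z] by (auto simp: U_def indicator_def)
  \<comment> \<open>Half of \<open>\<epsilon>\<close>, squared, so that the final inequality is
    strict.\<close>
  define e where "e = (\<epsilon> / 2)\<^sup>2"
  have e: "0 < e" using \<epsilon> by (simp add: e_def)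
  obtain d0 where d0: "d0 > 0" "\<And>h. norm h < d0 \<Longrightarrow> (\<integral>\<^sup>+z. ennreal ((U (z - h) - U z)\<^sup>2) \<partial>lborel) \<le> ennreal e"
    using L2_translation_continuous[OF U_meas U2_fin U_out e] by blast
  \<comment> \<open>\<open>d0 / 2\<close> because the product mollifier lives in
    \<open>norm h < 2 * d\<close>; \<open>1 / 4\<close> for the geometry of the cutoff;
    \<open>\<epsilon> / 3\<close> so that \<open>2 * d < \<epsilon>\<close>, which keeps the time
    margins inside \<open>(0, T)\<close>.\<close>
  define d where "d = Min {d0 / 2, 1 / 4, \<epsilon> / 3}"
  have d: "0 < d" "2 * d \<le> d0" "d \<le> 1 / 4" "2 * d < \<epsilon>"
    using d0(1) \<epsilon> by (auto simp: d_def min_def)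
  obtain b C where b: "\<And>k x. (b k has_real_derivative b (Suc k) x) (at x)"
    "\<And>k x. d \<le> \<bar>x\<bar> \<Longrightarrow> b k x = 0" "\<And>k x. \<bar>b k x\<bar> \<le> C * 4 ^ k * fact (2 * k)"
    "\<And>x. 0 \<le> b 0 x" "(b 0 has_integral 1) {-d..d}"
    using ex_gevrey_mollifier[OF d(1)] by blast
  obtain X :: "nat \<Rightarrow> real \<Rightarrow> real" where X: "\<And>k x. (X k has_real_derivative X (Suc k) x) (at x)"
    "\<And>k x. x \<le> - (1 / 4) \<Longrightarrow> X k x = 0" "\<And>x. 1 / 4 \<le> x \<Longrightarrow> X 0 x = 1"
    "\<And>k x. 1 / 4 \<le> x \<Longrightarrow> X (Suc k) x = 0"
    using ex_smooth_step[of "1 / 4"] by auto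
  \<comment> \<open>The shift centres the step at \<open>- N + 1 / 2\<close>, so that it rises
    between \<open>- N + 1 / 4\<close> and \<open>- N + 3 / 4\<close>.\<close>
  have X': "((\<lambda>y. X k (y + (N - 1 / 2))) has_real_derivative X (Suc k) (y + (N - 1 / 2))) (at y)" for k y
    using X(1)[of k "y + (N - 1 / 2)"] by (simp only: DERIV_shift)
  have AE_U: "AE z in lborel. U z \<noteq> 0 \<longrightarrow> t1 \<le> fst z \<and> fst z \<le> t2"
    using AE_zero_outside_ess_support[OF assms(7)]
    by eventually_elim (auto simp: U_def N_def indicator_def split: if_splits)
  have U_weak: "(\<integral>z. U z * kdvb_dual \<phi> z \<partial>lborel) = 0" if "\<phi> \<in> test_functions ?\<Omega>" for \<phi>
  proof -
    have "set_lebesgue_integral lborel ?\<Omega> (\<lambda>z. u z * kdvb_dual \<phi> z) = 0"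
      using solves_KdVB_iff[OF L2_imp_set_integrable[OF assms(5)]] assms(6) \<Omega> that by (simp add: N_def)
    then show ?thesis by (simp add: set_lebesgue_integral_def U_def mult.assoc)
  qed
  interpret kdvb_extension b C d N T t1 t2 "\<lambda>k y. X k (y + (N - 1 / 2))" U
  proof
    show "U z = 0" if "z \<notin> ?\<Omega>" for z using that by (simp add: U_def)
    show "X k (y + (N - 1 / 2)) = 0" if "y \<le> - N + 1 / 4" for k y using that by (intro X) simp
    show "X 0 (y + (N - 1 / 2)) = 1" if "- N + 3 / 4 \<le> y" for y using that by (intro X) simp
    show "X (Suc k) (y + (N - 1 / 2)) = 0" if "- N + 3 / 4 \<le> y" for k y using that by (intro X) simp
  qed (use b d N X' U_int AE_U U_weak \<epsilon> in auto)
  let ?\<Omega>' = "{0<..<T} \<times> {-N-1<..<N+1}"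
  have \<Omega>': "open ?\<Omega>'" "?\<Omega>' \<in> sets borel" "bounded ?\<Omega>'"
    by (auto intro!: bounded_Times borel_open open_Times)
  let ?I = "{0<..<T} \<times> {-N+1<..<N-1}"
  let ?B = "\<lambda>h. b 0 (fst h) * b 0 (snd h)"
  have b_hbi: "has_bochner_integral lborel (b 0) 1"
  proof -
    have "integrable lborel (b 0)"
      by (rule integrable_continuous_support[OF b_continuous, of "{-d..d}"]) (auto intro!: b(2))
    moreover have "(b 0 has_integral 1) UNIV"
      by (rule has_integral_on_superset[OF b(5)]) (auto intro!: b(2))
    ultimately show ?thesis
      using has_integral_integral_lborel[of "b 0"] has_integral_unique by (metis has_bochner_integral_iff)
  qed
  have B_int: "integrable lborel ?B"
    using integrable_tensor[of "b 0" "b 0"] b_hbi by (simp add: has_bochner_integral_iff lborel_prod split_def)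
  have B_1: "integral\<^sup>L lborel ?B = 1"
    using lborel_pair.integral_fst'[of ?B] B_int b_hbi by (simp add: has_bochner_integral_iff lborel_prod)
  have "(\<integral>\<^sup>+z. ennreal (((\<integral>s. U s * ?B (z - s) \<partial>lborel) - U z)\<^sup>2) \<partial>lborel) \<le> ennreal e"
  proof (rule mollify_L2_close[where d = "2 * d" and C = "C * C"])
    show "?B h = 0" if "2 * d \<le> norm h" for h
    proof -
      have "norm h \<le> \<bar>fst h\<bar> + \<bar>snd h\<bar>" using norm_Pair_le[of "fst h" "snd h"] by simp
      then have "d \<le> \<bar>fst h\<bar> \<or> d \<le> \<bar>snd h\<bar>" using that by linarith
      then show ?thesis using b(2)[of _ 0] by auto
    qed
    show "?B h \<le> C * C" for h
      using b(3)[of 0] b(4) C_nonneg by (intro mult_mono) (auto simp: abs_le_iff)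
  qed (use U_int U2_int B_int B_1 b(4) e d0(2) d(2) in \<open>auto intro: less_imp_le\<close>)
  moreover have "(\<integral>\<^sup>+z. ennreal (indicator ?I z *\<^sub>R (v z - u z)\<^sup>2) \<partial>lborel)
      \<le> (\<integral>\<^sup>+z. ennreal (((\<integral>s. U s * ?B (z - s) \<partial>lborel) - U z)\<^sup>2) \<partial>lborel)"
  proof (rule nn_integral_mono)
    fix z :: "real \<times> real"
    show "ennreal (indicator ?I z *\<^sub>R (v z - u z)\<^sup>2) \<le> ennreal (((\<integral>s. U s * ?B (z - s) \<partial>lborel) - U z)\<^sup>2)"
    proof (cases "z \<in> ?I")
      case True
      then have "v z = (\<integral>s. U s * ?B (z - s) \<partial>lborel)"
        using v_eq_mollified[of "snd z" "fst z"] by auto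
      moreover have "U z = u z" using True by (auto simp: U_def)
      ultimately show ?thesis using True by simp
    qed simp
  qed
  ultimately have nn: "(\<integral>\<^sup>+z. ennreal (indicator ?I z *\<^sub>R (v z - u z)\<^sup>2) \<partial>lborel) \<le> ennreal e"
    by (rule order_trans[rotated])
  have "(\<integral>z. indicator ?I z *\<^sub>R (v z - u z)\<^sup>2 \<partial>lborel) \<le> e"
  proof -
    \<comment> \<open>Measurability of \<open>u\<close> is known only on \<open>?\<Omega>\<close>;
      on \<open>?I\<close> it may be replaced by the Borel function \<open>U\<close>.\<close>
    have "(\<lambda>z. indicator ?I z *\<^sub>R (v z - u z)\<^sup>2) = (\<lambda>z. indicator ?I z *\<^sub>R (v z - U z)\<^sup>2)"
      by (auto simp: U_def fun_eq_iff indicator_def)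
    moreover have "\<dots> \<in> borel_measurable lborel"
      by (intro borel_measurable_scaleR borel_measurable_indicator borel_measurable_power borel_measurable_diff)
         (auto intro!: borel_open open_Times)
    ultimately have "(\<integral>z. indicator ?I z *\<^sub>R (v z - u z)\<^sup>2 \<partial>lborel)
        = enn2real (\<integral>\<^sup>+z. ennreal (indicator ?I z *\<^sub>R (v z - u z)\<^sup>2) \<partial>lborel)"
      by (intro integral_eq_nn_integral) auto
    also have "\<dots> \<le> e" using nn e by (intro enn2real_leI) auto
    finally show ?thesis .
  qed
  then have "L2_norm ?I (\<lambda>z. v z - u z) \<le> sqrt e"
    by (simp add: L2_norm_def set_lebesgue_integral_def)
  also have "\<dots> < \<epsilon>" using \<epsilon> by (simp add: e_def)
  finally have norm: "L2_norm ?I (\<lambda>z. v z - u z) < \<epsilon>" .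
  \<comment> \<open>\<open>ess_support_subset\<close> wants a set closed in the plane, hence
    \<open>UNIV\<close> in \<open>x\<close>; the restriction in \<open>x\<close> is recovered from
    \<open>ess_support ?\<Omega>' v \<subseteq> ?\<Omega>'\<close>.\<close>
  have "ess_support ?\<Omega>' v \<subseteq> {t1 - \<epsilon>..t2 + \<epsilon>} \<times> UNIV"
  proof (rule ess_support_subset[OF \<Omega>'(1)])
    show "v z = 0" if "z \<in> ?\<Omega>' - {t1 - \<epsilon>..t2 + \<epsilon>} \<times> UNIV" for z
    proof -
      obtain t x where z: "z = (t, x)" by (cases z)
      then have "t < t1 - \<epsilon> \<or> t2 + \<epsilon> < t" using that by auto
      then have "t < t1 - d \<or> t2 + d < t" using d(1,4) by linarith
      then show ?thesis unfolding z by (rule v_support)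
    qed
  qed (auto intro: closed_Times)
  moreover have "ess_support ?\<Omega>' v \<subseteq> ?\<Omega>'" by (auto simp: ess_support_def)
  ultimately have "ess_support ?\<Omega>' v \<subseteq> {t1 - \<epsilon>..t2 + \<epsilon>} \<times> {-N-1<..<N+1}" by blast
  then show "\<exists>v \<in> L2_space ({0<..<T} \<times> {- real n - 1<..<real n + 1}).
      solves_KdVB ({0<..<T} \<times> {- real n - 1<..<real n + 1}) v \<and>
      ess_support ({0<..<T} \<times> {- real n - 1<..<real n + 1}) v
        \<subseteq> {t1 - \<epsilon>..t2 + \<epsilon>} \<times> {- real n - 1<..<real n + 1} \<and>
      L2_norm ({0<..<T} \<times> {- real n + 1<..<real n - 1}) (\<lambda>z. v z - u z) < \<epsilon>"
    using norm v_solves v_L2[OF \<Omega>'(3,2)] unfolding N_def by blast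
qed

end
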